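(* Let $(\mathbb A,\mathsf E,\mathsf M)$ be a context. Every preneighbourhood morphism is continuous if and only if every dense preneighbourhood morphism is continuous.
   Context: A context is a triple $(\mathbb A,\mathsf E,\mathsf M)$ where $\mathbb A$ is a finitely complete category with finite coproducts, $(\mathsf E,\mathsf M)$ is a proper factorization system on $\mathbb A$ ($\mathsf E\subseteq$ epimorphisms, $\mathsf M\subseteq$ monomorphisms), and for each object $X$ the poset $\mathrm{Sub}(X)$ of admissible subobjects of $X$ ($\mathsf M$-morphisms with codomain $X$, equivalent ones identified) is a complete lattice, with largest element $\mathrm{id}_X$ and smallest element $\sigma_X$ (the $\mathsf M$-part of the factorization of the unique morphism from the initial object to $X$). For $f:X\to Y$, $f^{-1}n$ is the pullback of $n\in\mathrm{Sub}(Y)$ along $f$. A filter on $X$ is an up-closed subset of $\mathrm{Sub}(X)$ closed under finite meets; filters $\mathrm{Fil}(X)$ are ordered by inclusion. A preneighbourhood system on $X$ is an order preserving map $\mu:\mathrm{Sub}(X)^{\mathrm{op}}\to\mathrm{Fil}(X)$ with $\mu(\sigma_X)=\mathrm{Sub}(X)$ and $p\in\mu(m)\Rightarrow m\leq p$; $(X,\mu)$ is then an internal preneighbourhood space. A preneighbourhood morphism $f:(X,\mu)\to(Y,\phi)$ is a morphism $f:X\to Y$ such that $p\in\phi(u)\Rightarrow f^{-1}p\in\mu(f^{-1}u)$. Define $\mathtt{Far}_\mu p=\{x\in\mathrm{Sub}(X):(\exists u\in\mu(x))(u\wedge p=\sigma_X)\}$, $\mathrm{cl}_\mu p=\bigvee\{x\in\mathrm{Sub}(X):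 p\not< x\text{ and }x\notin\mathtt{Far}_\mu p\}$ and $\mathfrak C_\mu=\{p:\mathrm{cl}_\mu p=p\}$. A morphism $f:X\to Y$ between preneighbourhood spaces $(X,\mu)$, $(Y,\phi)$ is continuous if $t\in\mathfrak C_\phi\Rightarrow f^{-1}t\in\mathfrak C_\mu$, and dense if $f=m\circ h$ with $m\in\mathfrak C_\phi$ implies that $m$ is an isomorphism. *)

theory Defs
  imports "HOL-Algebra.Complete_Lattice"
begin

section \<open>Categories\<close>

record ('o, 'a) cat =
  Obj :: "'o set"
  Arr :: "'a set"
  Dom :: "'a \<Rightarrow> 'o"
  Cod :: "'a \<Rightarrow> 'o"
  Id :: "'o \<Rightarrow> 'a"
  Comp :: "'a \<Rightarrow> 'a \<Rightarrow> 'a" (infixl "\<cdot>\<index>" 75)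

definition Hom :: "('o, 'a) cat \<Rightarrow> 'o \<Rightarrow> 'o \<Rightarrow> 'a set" where
  "Hom C X Y = {f \<in> Arr C. Dom C f = X \<and> Cod C f = Y}"

text \<open>The composite \<open>g \<cdot> f\<close> is "g after f", and is unspecified unless
  \<open>Dom g = Cod f\<close>.\<close>

locale category =
  fixes C :: "('o, 'a) cat" (structure)
  assumes dom_obj: "f \<in> Arr C \<Longrightarrow> Dom C f \<in> Obj C"
    and cod_obj: "f \<in> Arr C \<Longrightarrow> Cod C f \<in> Obj C"
    and id_hom: "X \<in> Obj C \<Longrightarrow> Id C X \<in> Hom C X X"
    and comp_hom: "\<lbrakk>f \<in> Hom C X Y; g \<in> Hom C Y Z\<rbrakk> \<Longrightarrow> g \<cdot> f \<in> Hom C X Z"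
    and comp_id: "f \<in> Hom C X Y \<Longrightarrow> f \<cdot> Id C X = f"
    and id_comp: "f \<in> Hom C X Y \<Longrightarrow> Id C Y \<cdot> f = f"
    and comp_assoc: "\<lbrakk>f \<in> Hom C W X; g \<in> Hom C X Y; h \<in> Hom C Y Z\<rbrakk>
      \<Longrightarrow> (h \<cdot> g) \<cdot> f = h \<cdot> (g \<cdot> f)"

definition is_mono :: "('o, 'a) cat \<Rightarrow> 'a \<Rightarrow> bool" where
  "is_mono C m \<longleftrightarrow> m \<in> Arr C \<and>
    (\<forall>W. \<forall>f \<in> Hom C W (Dom C m). \<forall>g \<in> Hom C W (Dom C m).
      m \<cdot>\<^bsub>C\<^esub> f = m \<cdot>\<^bsub>C\<^esub> g \<longrightarrow> f = g)"

definition is_epi :: "('o, 'a) cat \<Rightarrow> 'a \<Rightarrow> bool" where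
  "is_epi C e \<longleftrightarrow> e \<in> Arr C \<and>
    (\<forall>Z. \<forall>f \<in> Hom C (Cod C e) Z. \<forall>g \<in> Hom C (Cod C e) Z.
      f \<cdot>\<^bsub>C\<^esub> e = g \<cdot>\<^bsub>C\<^esub> e \<longrightarrow> f = g)"

definition is_isomorphism :: "('o, 'a) cat \<Rightarrow> 'a \<Rightarrow> bool" where
  "is_isomorphism C f \<longleftrightarrow> f \<in> Arr C \<and>
    (\<exists>g \<in> Hom C (Cod C f) (Dom C f).
      g \<cdot>\<^bsub>C\<^esub> f = Id C (Dom C f) \<and> f \<cdot>\<^bsub>C\<^esub> g = Id C (Cod C f))"


section \<open>Finite limits and finite coproducts\<close>

definition is_functor ::
    "('i, 'j) cat \<Rightarrow> ('o, 'a) cat \<Rightarrow> ('i \<Rightarrow> 'o) \<Rightarrow> ('j \<Rightarrow> 'a) \<Rightarrow> bool" where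
  "is_functor J C F D \<longleftrightarrow>
    (\<forall>i \<in> Obj J. F i \<in> Obj C) \<and>
    (\<forall>a \<in> Arr J. D a \<in> Hom C (F (Dom J a)) (F (Cod J a))) \<and>
    (\<forall>i \<in> Obj J. D (Id J i) = Id C (F i)) \<and>
    (\<forall>a \<in> Arr J. \<forall>b \<in> Arr J. Dom J b = Cod J a \<longrightarrow> D (b \<cdot>\<^bsub>J\<^esub> a) = D b \<cdot>\<^bsub>C\<^esub> D a)"

definition is_cone ::
    "('i, 'j) cat \<Rightarrow> ('o, 'a) cat \<Rightarrow> ('i \<Rightarrow> 'o) \<Rightarrow> ('j \<Rightarrow> 'a) \<Rightarrow> 'o \<Rightarrow> ('i \<Rightarrow> 'a) \<Rightarrow> bool" where
  "is_cone J C F D L \<pi> \<longleftrightarrow>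
    L \<in> Obj C \<and> (\<forall>i \<in> Obj J. \<pi> i \<in> Hom C L (F i)) \<and>
    (\<forall>a \<in> Arr J. D a \<cdot>\<^bsub>C\<^esub> \<pi> (Dom J a) = \<pi> (Cod J a))"

definition is_limit ::
    "('i, 'j) cat \<Rightarrow> ('o, 'a) cat \<Rightarrow> ('i \<Rightarrow> 'o) \<Rightarrow> ('j \<Rightarrow> 'a) \<Rightarrow> 'o \<Rightarrow> ('i \<Rightarrow> 'a) \<Rightarrow> bool" where
  "is_limit J C F D L \<pi> \<longleftrightarrow> is_cone J C F D L \<pi> \<and>
    (\<forall>K \<kappa>. is_cone J C F D K \<kappa> \<longrightarrow>
      (\<exists>!u. u \<in> Hom C K L \<and> (\<forall>i \<in> Obj J. \<pi> i \<cdot>\<^bsub>C\<^esub> u = \<kappa> i)))"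

text \<open>Every finite category is isomorphic to one whose objects and arrows are natural
  numbers, so quantifying over the latter covers all finite diagrams.\<close>

definition finitely_complete :: "('o, 'a) cat \<Rightarrow> bool" where
  "finitely_complete C \<longleftrightarrow>
    (\<forall>(J :: (nat, nat) cat) F D.
      category J \<and> finite (Obj J) \<and> finite (Arr J) \<and> is_functor J C F D \<longrightarrow>
      (\<exists>L \<pi>. is_limit J C F D L \<pi>))"

definition is_coproduct ::
    "('o, 'a) cat \<Rightarrow> 'i set \<Rightarrow> ('i \<Rightarrow> 'o) \<Rightarrow> 'o \<Rightarrow> ('i \<Rightarrow> 'a) \<Rightarrow> bool" where
  "is_coproduct C I F S \<iota> \<longleftrightarrow>
    S \<in> Obj C \<and> (\<forall>i \<in> I. \<iota> i \<in> Hom C (F i) S) \<and>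
    (\<forall>T \<in> Obj C. \<forall>\<kappa>. (\<forall>i \<in> I. \<kappa> i \<in> Hom C (F i) T) \<longrightarrow>
      (\<exists>!u. u \<in> Hom C S T \<and> (\<forall>i \<in> I. u \<cdot>\<^bsub>C\<^esub> \<iota> i = \<kappa> i)))"

definition has_finite_coproducts :: "('o, 'a) cat \<Rightarrow> bool" where
  "has_finite_coproducts C \<longleftrightarrow>
    (\<forall>(I :: nat set) F. finite I \<and> (\<forall>i \<in> I. F i \<in> Obj C) \<longrightarrow>
      (\<exists>S \<iota>. is_coproduct C I F S \<iota>))"

definition is_initial :: "('o, 'a) cat \<Rightarrow> 'o \<Rightarrow> bool" where
  "is_initial C I \<longleftrightarrow> I \<in> Obj C \<and> (\<forall>X \<in> Obj C. \<exists>!f. f \<in> Hom C I X)"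

text \<open>\<open>is_pullback C f n p q\<close>: the square \<open>f \<cdot> p = n \<cdot> q\<close> is a pullback, so that \<open>p\<close> is a
  pullback of \<open>n\<close> along \<open>f\<close>.\<close>

definition is_pullback :: "('o, 'a) cat \<Rightarrow> 'a \<Rightarrow> 'a \<Rightarrow> 'a \<Rightarrow> 'a \<Rightarrow> bool" where
  "is_pullback C f n p q \<longleftrightarrow>
    f \<in> Arr C \<and> n \<in> Arr C \<and> Cod C f = Cod C n \<and>
    p \<in> Hom C (Dom C p) (Dom C f) \<and> q \<in> Hom C (Dom C p) (Dom C n) \<and>
    f \<cdot>\<^bsub>C\<^esub> p = n \<cdot>\<^bsub>C\<^esub> q \<and>
    (\<forall>W. \<forall>a \<in> Hom C W (Dom C f). \<forall>b \<in> Hom C W (Dom C n).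
      f \<cdot>\<^bsub>C\<^esub> a = n \<cdot>\<^bsub>C\<^esub> b \<longrightarrow>
      (\<exists>!u. u \<in> Hom C W (Dom C p) \<and> p \<cdot>\<^bsub>C\<^esub> u = a \<and> q \<cdot>\<^bsub>C\<^esub> u = b))"


section \<open>Proper factorization systems\<close>

definition factorization_system :: "('o, 'a) cat \<Rightarrow> 'a set \<Rightarrow> 'a set \<Rightarrow> bool" where
  "factorization_system C E M \<longleftrightarrow>
    E \<subseteq> Arr C \<and> M \<subseteq> Arr C \<and>
    (\<forall>e \<in> E. \<forall>i. is_isomorphism C i \<and> Dom C i = Cod C e \<longrightarrow> i \<cdot>\<^bsub>C\<^esub> e \<in> E) \<and>
    (\<forall>m \<in> M. \<forall>i. is_isomorphism C i \<and> Cod C i = Dom C m \<longrightarrow> m \<cdot>\<^bsub>C\<^esub> i \<in> M) \<and>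
    (\<forall>f \<in> Arr C. \<exists>e \<in> E. \<exists>m \<in> M. Cod C e = Dom C m \<and> f = m \<cdot>\<^bsub>C\<^esub> e) \<and>
    (\<forall>e \<in> E. \<forall>m \<in> M. \<forall>f \<in> Hom C (Dom C e) (Dom C m). \<forall>g \<in> Hom C (Cod C e) (Cod C m).
      g \<cdot>\<^bsub>C\<^esub> e = m \<cdot>\<^bsub>C\<^esub> f \<longrightarrow>
      (\<exists>!d. d \<in> Hom C (Cod C e) (Dom C m) \<and> d \<cdot>\<^bsub>C\<^esub> e = f \<and> m \<cdot>\<^bsub>C\<^esub> d = g))"

definition proper_factorization_system :: "('o, 'a) cat \<Rightarrow> 'a set \<Rightarrow> 'a set \<Rightarrow> bool" where
  "proper_factorization_system C E M \<longleftrightarrow>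
    factorization_system C E M \<and> (\<forall>e \<in> E. is_epi C e) \<and> (\<forall>m \<in> M. is_mono C m)"


section \<open>Admissible subobjects and contexts\<close>

definition admissible :: "('o, 'a) cat \<Rightarrow> 'a set \<Rightarrow> 'o \<Rightarrow> 'a set" where
  "admissible C M X = {m \<in> M. Cod C m = X}"

definition factors_through :: "('o, 'a) cat \<Rightarrow> 'a \<Rightarrow> 'a \<Rightarrow> bool" where
  "factors_through C m n \<longleftrightarrow> (\<exists>k \<in> Hom C (Dom C m) (Dom C n). m = n \<cdot>\<^bsub>C\<^esub> k)"

definition sub_equiv :: "('o, 'a) cat \<Rightarrow> 'a set \<Rightarrow> 'o \<Rightarrow> ('a \<times> 'a) set" where
  "sub_equiv C M X = {(m, n). m \<in> admissible C M X \<and> n \<in> admissible C M X \<and>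
    factors_through C m n \<and> factors_through C n m}"

text \<open>An element of \<open>Sub X\<close> is an equivalence class of \<open>M\<close>-morphisms; the order does not
  depend on the choice of representatives.\<close>

definition Sub :: "('o, 'a) cat \<Rightarrow> 'a set \<Rightarrow> 'o \<Rightarrow> 'a set gorder" where
  "Sub C M X =
    \<lparr>carrier = admissible C M X // sub_equiv C M X,
     eq = (=),
     le = (\<lambda>p q. \<exists>m \<in> p. \<exists>n \<in> q. factors_through C m n)\<rparr>"

locale preneighbourhood_context = category C
  for C :: "('o, 'a) cat" (structure) and E M :: "'a set" +
  assumes finitely_complete: "finitely_complete C"
    and has_finite_coproducts: "has_finite_coproducts C"
    and proper_factorization_system: "proper_factorization_system C E M"
    and complete_lattice_Sub: "X \<in> Obj C \<Longrightarrow> complete_lattice (Sub C M X)"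

text \<open>The next two definitions describe an equivalence class by all of its members:
  initial objects, factorizations and pullbacks are unique up to isomorphism, and
  \<open>M\<close> is closed under isomorphisms and stable under pullback.\<close>

definition smallest_sub :: "('o, 'a) cat \<Rightarrow> 'a set \<Rightarrow> 'a set \<Rightarrow> 'o \<Rightarrow> 'a set" where
  "smallest_sub C E M X = {m \<in> admissible C M X.
    \<exists>I e. is_initial C I \<and> e \<in> E \<and> e \<in> Hom C I (Dom C m)}"

definition preimage :: "('o, 'a) cat \<Rightarrow> 'a \<Rightarrow> 'a set \<Rightarrow> 'a set" where
  "preimage C f p = {m. \<exists>n \<in> p. \<exists>q. is_pullback C f n m q}"


section \<open>Preneighbourhood spaces\<close>

text \<open>The empty meet is included, so every filter contains the top element; the improper
  filter is allowed.\<close>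

definition Fil :: "('o, 'a) cat \<Rightarrow> 'a set \<Rightarrow> 'o \<Rightarrow> 'a set set set" where
  "Fil C M X = {F. F \<subseteq> carrier (Sub C M X) \<and>
    (\<forall>p \<in> F. \<forall>q \<in> carrier (Sub C M X). p \<sqsubseteq>\<^bsub>Sub C M X\<^esub> q \<longrightarrow> q \<in> F) \<and>
    (\<forall>S. finite S \<and> S \<subseteq> F \<longrightarrow> \<Sqinter>\<^bsub>Sub C M X\<^esub> S \<in> F)}"

definition preneighbourhood_system ::
    "('o, 'a) cat \<Rightarrow> 'a set \<Rightarrow> 'a set \<Rightarrow> 'o \<Rightarrow> ('a set \<Rightarrow> 'a set set) \<Rightarrow> bool" where
  "preneighbourhood_system C E M X \<mu> \<longleftrightarrow>
    \<mu> \<in> carrier (Sub C M X) \<rightarrow> Fil C M X \<and>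
    (\<forall>m \<in> carrier (Sub C M X). \<forall>n \<in> carrier (Sub C M X).
      m \<sqsubseteq>\<^bsub>Sub C M X\<^esub> n \<longrightarrow> \<mu> n \<subseteq> \<mu> m) \<and>
    \<mu> (smallest_sub C E M X) = carrier (Sub C M X) \<and>
    (\<forall>m \<in> carrier (Sub C M X). \<forall>p \<in> \<mu> m. m \<sqsubseteq>\<^bsub>Sub C M X\<^esub> p)"

definition preneighbourhood_space ::
    "('o, 'a) cat \<Rightarrow> 'a set \<Rightarrow> 'a set \<Rightarrow> 'o \<Rightarrow> ('a set \<Rightarrow> 'a set set) \<Rightarrow> bool" where
  "preneighbourhood_space C E M X \<mu> \<longleftrightarrow> X \<in> Obj C \<and> preneighbourhood_system C E M X \<mu>"

definition preneighbourhood_morphism ::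
    "('o, 'a) cat \<Rightarrow> 'a set \<Rightarrow> 'a set \<Rightarrow> 'o \<Rightarrow> ('a set \<Rightarrow> 'a set set) \<Rightarrow>
      'o \<Rightarrow> ('a set \<Rightarrow> 'a set set) \<Rightarrow> 'a \<Rightarrow> bool" where
  "preneighbourhood_morphism C E M X \<mu> Y \<phi> f \<longleftrightarrow>
    preneighbourhood_space C E M X \<mu> \<and> preneighbourhood_space C E M Y \<phi> \<and> f \<in> Hom C X Y \<and>
    (\<forall>u \<in> carrier (Sub C M Y). \<forall>p \<in> \<phi> u. preimage C f p \<in> \<mu> (preimage C f u))"

definition Far ::
    "('o, 'a) cat \<Rightarrow> 'a set \<Rightarrow> 'a set \<Rightarrow> 'o \<Rightarrow> ('a set \<Rightarrow> 'a set set) \<Rightarrow> 'a set \<Rightarrow> 'a set set" where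
  "Far C E M X \<mu> p = {x \<in> carrier (Sub C M X).
    \<exists>u \<in> \<mu> x. u \<sqinter>\<^bsub>Sub C M X\<^esub> p = smallest_sub C E M X}"

definition cl ::
    "('o, 'a) cat \<Rightarrow> 'a set \<Rightarrow> 'a set \<Rightarrow> 'o \<Rightarrow> ('a set \<Rightarrow> 'a set set) \<Rightarrow> 'a set \<Rightarrow> 'a set" where
  "cl C E M X \<mu> p = \<Squnion>\<^bsub>Sub C M X\<^esub> {x \<in> carrier (Sub C M X).
    \<not> p \<sqsubset>\<^bsub>Sub C M X\<^esub> x \<and> x \<notin> Far C E M X \<mu> p}"

definition closed_subs ::
    "('o, 'a) cat \<Rightarrow> 'a set \<Rightarrow> 'a set \<Rightarrow> 'o \<Rightarrow> ('a set \<Rightarrow> 'a set set) \<Rightarrow> 'a set set" where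
  "closed_subs C E M X \<mu> = {p \<in> carrier (Sub C M X). cl C E M X \<mu> p = p}"

definition continuous_morphism ::
    "('o, 'a) cat \<Rightarrow> 'a set \<Rightarrow> 'a set \<Rightarrow> 'o \<Rightarrow> ('a set \<Rightarrow> 'a set set) \<Rightarrow>
      'o \<Rightarrow> ('a set \<Rightarrow> 'a set set) \<Rightarrow> 'a \<Rightarrow> bool" where
  "continuous_morphism C E M X \<mu> Y \<phi> f \<longleftrightarrow>
    preneighbourhood_space C E M X \<mu> \<and> preneighbourhood_space C E M Y \<phi> \<and> f \<in> Hom C X Y \<and>
    (\<forall>t \<in> closed_subs C E M Y \<phi>. preimage C f t \<in> closed_subs C E M X \<mu>)"

definition dense_morphism ::
    "('o, 'a) cat \<Rightarrow> 'a set \<Rightarrow> 'a set \<Rightarrow> 'o \<Rightarrow> ('a set \<Rightarrow> 'a set set) \<Rightarrow>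
      'o \<Rightarrow> ('a set \<Rightarrow> 'a set set) \<Rightarrow> 'a \<Rightarrow> bool" where
  "dense_morphism C E M X \<mu> Y \<phi> f \<longleftrightarrow>
    preneighbourhood_space C E M X \<mu> \<and> preneighbourhood_space C E M Y \<phi> \<and> f \<in> Hom C X Y \<and>
    (\<forall>t \<in> closed_subs C E M Y \<phi>. \<forall>m \<in> t. \<forall>h \<in> Hom C X (Dom C m).
      f = m \<cdot>\<^bsub>C\<^esub> h \<longrightarrow> is_isomorphism C m)"

end

theory Submission
  imports Defs
begin

text \<open>Only one direction needs an argument: continuity of the dense morphisms must be spread to an
  arbitrary preneighbourhood morphism \<open>f : (X, \<mu>) \<rightarrow> (Y, \<phi>)\<close>. This is done by factoring \<open>f = m \<cdot> h\<close>,
  where \<open>m\<close> is the smallest closed subobject through which \<open>f\<close> factors and \<open>h\<close> is dense.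

  Everything rests on a description of the closed subobjects without suprema: \<open>p\<close> is closed if
  and only if every subobject is comparable with \<open>p\<close> or far from \<open>p\<close> (\<open>closed_iff\<close>). It shows at
  once that arbitrary infima of closed subobjects are closed (\<open>closed_Inf\<close>), so that \<open>m\<close> exists.

  The domain of \<open>m\<close> carries the restriction of \<open>\<phi>\<close>, whose neighbourhoods of \<open>u\<close> are generated by
  the preimages of the neighbourhoods of the image of \<open>u\<close> (\<open>restrict_system_space\<close>), and \<open>h\<close> is a
  preneighbourhood morphism into this space (\<open>morphism_into_restriction\<close>). The description of
  closedness passes between the two spaces in both directions: the preimage along \<open>m\<close> of a closed
  subobject is closed (\<open>closed_preimage\<close>), and, \<open>m\<close> being closed, so is the direct image of a
  closed subobject (\<open>closed_direct_image\<close>). The second fact and the minimality of \<open>m\<close> make \<open>h\<close>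
  dense (\<open>dense_if_least_closed\<close>), hence continuous by hypothesis; by the first, the preimage of a
  closed \<open>t\<close> along \<open>f\<close>, which is the preimage along \<open>h\<close> of its preimage along \<open>m\<close>, is closed.

  The categorical input is that the admissible monomorphisms compose and are stable under
  pullback, that preimages are functorial and monotone, and that direct image along \<open>m\<close> is an order
  embedding, left adjoint to preimage, which preserves the smallest subobject. Subobjects are
  handled throughout by their generalised elements, the arrows that factor through them.\<close>

section \<open>Admissible monomorphisms and pullbacks\<close>

context category
begin

lemma hom_self: "f \<in> Arr C \<Longrightarrow> f \<in> Hom C (Dom C f) (Cod C f)"
  by (simp add: Hom_def)

lemma homD:
  assumes "f \<in> Hom C X Y"
  shows "f \<in> Arr C" "Dom C f = X" "Cod C f = Y"
  using assms by (simp_all add: Hom_def)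

lemma mono_cancel:
  assumes "is_mono C m" "f \<in> Hom C W (Dom C m)" "g \<in> Hom C W (Dom C m)" "m \<cdot> f = m \<cdot> g"
  shows "f = g"
  using assms unfolding is_mono_def by blast

lemma epi_cancel:
  assumes "is_epi C e" "f \<in> Hom C (Cod C e) Z" "g \<in> Hom C (Cod C e) Z" "f \<cdot> e = g \<cdot> e"
  shows "f = g"
  using assms unfolding is_epi_def by blast

lemma factors_through_refl: "m \<in> Arr C \<Longrightarrow> factors_through C m m"
  unfolding factors_through_def
  by (metis comp_id dom_obj hom_self id_hom)

lemma factors_through_cod:
  assumes "factors_through C m n" "n \<in> Arr C"
  shows "m \<in> Arr C" "Cod C m = Cod C n"
  using assms comp_hom[of _ "Dom C m" "Dom C n" n "Cod C n"] hom_self homD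
  unfolding factors_through_def by metis+

lemma factors_through_comp:
  assumes "factors_through C m n" "n \<in> Arr C" "k \<in> Hom C W (Dom C m)"
  shows "factors_through C (m \<cdot> k) n"
proof -
  obtain a where a: "a \<in> Hom C (Dom C m) (Dom C n)" "m = n \<cdot> a"
    using assms(1) by (auto simp: factors_through_def)
  have "m \<cdot> k = n \<cdot> (a \<cdot> k)"
    using comp_assoc[OF assms(3) a(1) hom_self[OF assms(2)]] a(2) by simp
  moreover have "a \<cdot> k \<in> Hom C W (Dom C n)"
    using comp_hom[OF assms(3) a(1)] .
  moreover have "Dom C (m \<cdot> k) = W"
    using comp_hom[OF assms(3) hom_self[OF factors_through_cod(1)[OF assms(1,2)]]] homD by blast
  ultimately show ?thesis unfolding factors_through_def by auto
qed

lemma factors_through_trans: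
  assumes "factors_through C m n" "factors_through C n k" "k \<in> Arr C"
  shows "factors_through C m k"
  using assms factors_through_comp unfolding factors_through_def by metis

lemma pullback_factors_through:
  assumes "is_pullback C f n a q" "g \<in> Hom C W (Dom C f)"
  shows "factors_through C g a \<longleftrightarrow> factors_through C (f \<cdot> g) n"
proof -
  have f: "f \<in> Hom C (Dom C f) (Cod C f)" and n: "n \<in> Hom C (Dom C n) (Cod C f)"
    and a: "a \<in> Hom C (Dom C a) (Dom C f)" and q: "q \<in> Hom C (Dom C a) (Dom C n)"
    and e: "f \<cdot> a = n \<cdot> q"
    using assms(1) unfolding is_pullback_def by (auto simp: Hom_def)
  have fg: "Dom C (f \<cdot> g) = W" "Dom C g = W"
    using comp_hom[OF assms(2) f] assms(2) homD by metis+
  show ?thesis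
  proof
    assume "factors_through C g a"
    then obtain k where k: "k \<in> Hom C W (Dom C a)" "g = a \<cdot> k"
      using fg by (auto simp: factors_through_def)
    have "f \<cdot> g = n \<cdot> (q \<cdot> k)"
      using comp_assoc[OF k(1) a f] comp_assoc[OF k(1) q n] e k by simp
    then show "factors_through C (f \<cdot> g) n"
      using comp_hom[OF k(1) q] fg by (auto simp: factors_through_def)
  next
    assume "factors_through C (f \<cdot> g) n"
    then obtain b where "b \<in> Hom C W (Dom C n)" "f \<cdot> g = n \<cdot> b"
      using fg by (auto simp: factors_through_def)
    then obtain u where "u \<in> Hom C W (Dom C a)" "a \<cdot> u = g"
      using assms unfolding is_pullback_def by blast
    then show "factors_through C g a"
      using fg by (auto simp: factors_through_def)
  qed
qed

text \<open>For monomorphisms the second projection of a pullback is determined by the first, so that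
  being a pullback of \<open>n\<close> along \<open>f\<close> is only a matter of which arrows factor through it.\<close>

lemma pullbackI:
  assumes f: "f \<in> Hom C X Y" and n: "is_mono C n" "Cod C n = Y"
    and a: "is_mono C a" "Cod C a = X"
    and char: "\<And>W g. g \<in> Hom C W X \<Longrightarrow> factors_through C g a \<longleftrightarrow> factors_through C (f \<cdot> g) n"
  shows "\<exists>q. is_pullback C f n a q"
proof -
  have aH: "a \<in> Hom C (Dom C a) X" and nH: "n \<in> Hom C (Dom C n) Y"
    using n a by (auto simp: is_mono_def Hom_def)
  have "factors_through C (f \<cdot> a) n"
    using char[OF aH] factors_through_refl homD(1)[OF aH] by blast
  then obtain q where q: "q \<in> Hom C (Dom C a) (Dom C n)" "f \<cdot> a = n \<cdot> q"
    using homD(2)[OF comp_hom[OF aH f]] by (auto simp: factors_through_def)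
  have "\<exists>!u. u \<in> Hom C W (Dom C a) \<and> a \<cdot> u = s \<and> q \<cdot> u = b"
    if s: "s \<in> Hom C W X" and b: "b \<in> Hom C W (Dom C n)" and sb: "f \<cdot> s = n \<cdot> b" for W s b
  proof -
    have "factors_through C (f \<cdot> s) n"
      using b sb homD(2)[OF comp_hom[OF s f]] by (auto simp: factors_through_def)
    then obtain u where u: "u \<in> Hom C W (Dom C a)" "s = a \<cdot> u"
      using char[OF s] homD(2)[OF s] by (auto simp: factors_through_def)
    have "n \<cdot> (q \<cdot> u) = n \<cdot> b"
      using comp_assoc[OF u(1) q(1) nH] comp_assoc[OF u(1) aH f] q u sb by simp
    then have "q \<cdot> u = b"
      using mono_cancel[OF n(1) comp_hom[OF u(1) q(1)] b] by blast
    then show ?thesis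
      using u mono_cancel[OF a(1)] by blast
  qed
  then have "is_pullback C f n a q"
    unfolding is_pullback_def using f n a q aH nH by (auto simp: Hom_def)
  then show ?thesis ..
qed

end

text \<open>The shape \<open>0 \<rightarrow> 2 \<leftarrow> 1\<close> of a cospan: the arrows \<open>0, 1, 2\<close> are the identities, and the arrows
  \<open>3\<close> and \<open>4\<close> are the two legs.\<close>

definition cospan :: "(nat, nat) cat" where
  "cospan = \<lparr>Obj = {..<3}, Arr = {..<5},
     Dom = (\<lambda>a. if a = 3 then 0 else if a = 4 then 1 else a),
     Cod = (\<lambda>a. if a < 3 then a else 2),
     Id = (\<lambda>i. i),
     Comp = (\<lambda>b a. if a < 3 then b else a)\<rparr>"

lemma category_cospan: "category cospan"
  by unfold_locales (auto simp: cospan_def Hom_def split: if_splits)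

lemma cospan_simps:
  "Obj cospan = {0, Suc 0, 2}" "Arr cospan = {0, Suc 0, 2, 3, 4}" "Id cospan i = i"
  "Dom cospan a = (if a = 3 then 0 else if a = 4 then 1 else a)"
  "Cod cospan a = (if a < 3 then a else 2)"
  "Comp cospan b a = (if a < 3 then b else a)"
  by (auto simp: cospan_def)

context preneighbourhood_context
begin

lemma factorization_system: "factorization_system C E M"
  using proper_factorization_system by (simp add: proper_factorization_system_def)

lemma E_epi: "e \<in> E \<Longrightarrow> is_epi C e" and M_mono: "m \<in> M \<Longrightarrow> is_mono C m"
  using proper_factorization_system by (auto simp: proper_factorization_system_def)

lemma E_arr: "e \<in> E \<Longrightarrow> e \<in> Arr C" and M_arr: "m \<in> M \<Longrightarrow> m \<in> Arr C"
  using factorization_system by (auto simp: factorization_system_def)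

lemma M_hom: "m \<in> M \<Longrightarrow> m \<in> Hom C (Dom C m) (Cod C m)"
  by (simp add: M_arr hom_self)

lemma factorize:
  assumes "f \<in> Arr C"
  obtains e m where "e \<in> E" "m \<in> M" "Cod C e = Dom C m" "f = m \<cdot> e"
  using factorization_system assms unfolding factorization_system_def by blast

lemma fill_in:
  assumes "e \<in> E" "m \<in> M" "f \<in> Hom C (Dom C e) (Dom C m)" "g \<in> Hom C (Cod C e) (Cod C m)"
    "g \<cdot> e = m \<cdot> f"
  obtains d where "d \<in> Hom C (Cod C e) (Dom C m)" "d \<cdot> e = f" "m \<cdot> d = g"
  using factorization_system assms unfolding factorization_system_def by blast

text \<open>An arrow with the right lifting property against \<open>E\<close> lifts against the \<open>E\<close>-part of its own
  factorization; that part is then a split monomorphism and an epimorphism, hence invertible.\<close>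

lemma M_if_fill_in:
  assumes f: "f \<in> Arr C"
    and lift: "\<And>e a b. \<lbrakk>e \<in> E; a \<in> Hom C (Dom C e) (Dom C f); b \<in> Hom C (Cod C e) (Cod C f);
      b \<cdot> e = f \<cdot> a\<rbrakk> \<Longrightarrow> \<exists>d \<in> Hom C (Cod C e) (Dom C f). d \<cdot> e = a \<and> f \<cdot> d = b"
  shows "f \<in> M"
proof -
  obtain e m where em: "e \<in> E" "m \<in> M" "Cod C e = Dom C m" "f = m \<cdot> e"
    using factorize[OF f] .
  have e: "e \<in> Hom C (Dom C e) (Dom C m)" and m: "m \<in> Hom C (Dom C m) (Cod C m)"
    using em E_arr M_arr by (auto simp: Hom_def)
  have fH: "f \<in> Hom C (Dom C e) (Cod C m)"
    using comp_hom[OF e m] em by simp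
  have D: "Dom C e = Dom C f" "Cod C m = Cod C f" using homD[OF fH] by simp_all
  obtain d where d: "d \<in> Hom C (Dom C m) (Dom C f)" "d \<cdot> e = Id C (Dom C f)" "f \<cdot> d = m"
  proof -
    have "Id C (Dom C f) \<in> Hom C (Dom C e) (Dom C f)" using id_hom[OF dom_obj[OF f]] D by simp
    moreover have "m \<in> Hom C (Cod C e) (Cod C f)" using m em(3) D by simp
    moreover have "m \<cdot> e = f \<cdot> Id C (Dom C f)" using comp_id[OF hom_self[OF f]] em(4) by simp
    ultimately show ?thesis using lift[OF em(1)] that em(3) by metis
  qed
  have "(e \<cdot> d) \<cdot> e = Id C (Dom C m) \<cdot> e"
    using comp_assoc[of e "Dom C f" "Dom C m" d "Dom C f" e "Dom C m"] e d D
      comp_id[OF e] id_comp[OF e] by simp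
  then have "e \<cdot> d = Id C (Dom C m)"
    using epi_cancel[OF E_epi[OF em(1)], of "e \<cdot> d" "Dom C m" "Id C (Dom C m)"]
      comp_hom[of d "Dom C m" "Dom C f" e "Dom C m"] d(1) e D(1) id_hom[OF dom_obj[OF M_arr[OF em(2)]]]
      em(3) by simp
  then have "is_isomorphism C e"
    unfolding is_isomorphism_def using e d D em E_arr by (auto simp: Hom_def)
  then show ?thesis
    using factorization_system em unfolding factorization_system_def by blast
qed

lemma M_comp:
  assumes m: "m \<in> M" and n: "n \<in> M" and mn: "Cod C n = Dom C m"
  shows "m \<cdot> n \<in> M"
proof (rule M_if_fill_in)
  have nH: "n \<in> Hom C (Dom C n) (Dom C m)" and mH: "m \<in> Hom C (Dom C m) (Cod C m)"
    using M_hom[OF n] M_hom[OF m] mn by simp_all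
  have mnH: "m \<cdot> n \<in> Hom C (Dom C n) (Cod C m)" using comp_hom[OF nH mH] .
  then show "m \<cdot> n \<in> Arr C" by (rule homD)
  fix e a b
  assume e: "e \<in> E" and a: "a \<in> Hom C (Dom C e) (Dom C (m \<cdot> n))"
    and b: "b \<in> Hom C (Cod C e) (Cod C (m \<cdot> n))" and sq: "b \<cdot> e = (m \<cdot> n) \<cdot> a"
  have a: "a \<in> Hom C (Dom C e) (Dom C n)" and b: "b \<in> Hom C (Cod C e) (Cod C m)"
    using a b homD[OF mnH] by simp_all
  have "b \<cdot> e = m \<cdot> (n \<cdot> a)"
    using sq comp_assoc[OF a nH mH] by simp
  then obtain c where c: "c \<in> Hom C (Cod C e) (Dom C m)" "c \<cdot> e = n \<cdot> a" "m \<cdot> c = b"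
    using fill_in[OF e m comp_hom[OF a nH] b] by blast
  then obtain d where d: "d \<in> Hom C (Cod C e) (Dom C n)" "d \<cdot> e = a" "n \<cdot> d = c"
    using fill_in[OF e n a, of c] mn by auto
  have "(m \<cdot> n) \<cdot> d = b" using comp_assoc[OF d(1) nH mH] c d by simp
  then show "\<exists>d \<in> Hom C (Cod C e) (Dom C (m \<cdot> n)). d \<cdot> e = a \<and> (m \<cdot> n) \<cdot> d = b"
    using d homD[OF mnH] by auto
qed

lemma M_pullback:
  assumes pb: "is_pullback C f n p q" and n: "n \<in> M"
  shows "p \<in> M"
proof (rule M_if_fill_in)
  have f: "f \<in> Hom C (Dom C f) (Cod C n)" and nH: "n \<in> Hom C (Dom C n) (Cod C n)"
    and p: "p \<in> Hom C (Dom C p) (Dom C f)" and q: "q \<in> Hom C (Dom C p) (Dom C n)"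
    and sq: "f \<cdot> p = n \<cdot> q"
    using pb unfolding is_pullback_def by (auto simp: Hom_def)
  then show "p \<in> Arr C" by (auto simp: Hom_def)
  fix e a b
  assume e: "e \<in> E" and a: "a \<in> Hom C (Dom C e) (Dom C p)"
    and b: "b \<in> Hom C (Cod C e) (Cod C p)" and ba: "b \<cdot> e = p \<cdot> a"
  have b: "b \<in> Hom C (Cod C e) (Dom C f)" using b homD[OF p] by simp
  have eH: "e \<in> Hom C (Dom C e) (Cod C e)" using E_arr[OF e] by (rule hom_self)
  have "(f \<cdot> b) \<cdot> e = n \<cdot> (q \<cdot> a)"
    using comp_assoc[OF eH b f] comp_assoc[OF a p f] comp_assoc[OF a q nH] ba sq by simp
  then obtain c where c: "c \<in> Hom C (Cod C e) (Dom C n)" "n \<cdot> c = f \<cdot> b"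
    using fill_in[OF e n comp_hom[OF a q] comp_hom[OF b f]] by blast
  then obtain d where d: "d \<in> Hom C (Cod C e) (Dom C p)" "p \<cdot> d = b" "q \<cdot> d = c"
    using pb b unfolding is_pullback_def by metis
  have uniq: "u = v" if "u \<in> Hom C (Dom C e) (Dom C p)" "v \<in> Hom C (Dom C e) (Dom C p)"
    "p \<cdot> u = p \<cdot> v" "q \<cdot> u = q \<cdot> v" for u v
  proof -
    have "f \<cdot> (p \<cdot> u) = n \<cdot> (q \<cdot> u)"
      using comp_assoc[OF that(1) p f] comp_assoc[OF that(1) q nH] sq by simp
    then have "\<exists>!w. w \<in> Hom C (Dom C e) (Dom C p) \<and> p \<cdot> w = p \<cdot> u \<and> q \<cdot> w = q \<cdot> u"
      using pb comp_hom[OF that(1) p] comp_hom[OF that(1) q] unfolding is_pullback_def by blast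
    then show ?thesis using that by metis
  qed
  have de: "d \<cdot> e \<in> Hom C (Dom C e) (Dom C p)" using comp_hom[OF eH d(1)] .
  have pde: "p \<cdot> (d \<cdot> e) = p \<cdot> a"
    using comp_assoc[OF eH d(1) p] d ba by simp
  have "n \<cdot> (q \<cdot> (d \<cdot> e)) = n \<cdot> (q \<cdot> a)"
    using comp_assoc[OF de q nH] comp_assoc[OF de p f] comp_assoc[OF a q nH] comp_assoc[OF a p f]
      pde sq by simp
  then have "q \<cdot> (d \<cdot> e) = q \<cdot> a"
    using mono_cancel[OF M_mono[OF n] comp_hom[OF de q] comp_hom[OF a q]] by blast
  then have "d \<cdot> e = a" using uniq[OF de a pde] by blast
  then show "\<exists>d \<in> Hom C (Cod C e) (Dom C p). d \<cdot> e = a \<and> p \<cdot> d = b"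
    using d by blast
qed

lemma pullback_exists:
  assumes f: "f \<in> Hom C X Y" and n: "n \<in> Hom C Z Y"
  shows "\<exists>p q. is_pullback C f n p q"
proof -
  define F where "F i = (if i = 0 then X else if i = 1 then Z else Y)" for i :: nat
  define D where
    "D a = (if a = 3 then f else if a = 4 then n else Id C (F a))" for a :: nat
  have O: "X \<in> Obj C" "Y \<in> Obj C" "Z \<in> Obj C"
    using f n dom_obj cod_obj homD by metis+
  have F_simps: "F 0 = X" "F (Suc 0) = Z" "F 2 = Y" by (simp_all add: F_def)
  have D_simps: "D 0 = Id C X" "D (Suc 0) = Id C Z" "D 2 = Id C Y" "D 3 = f" "D 4 = n"
    by (simp_all add: D_def F_simps)
  have idH: "Id C X \<in> Hom C X X" "Id C Y \<in> Hom C Y Y" "Id C Z \<in> Hom C Z Z"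
    using O id_hom by blast+
  have unit: "Id C X \<cdot> Id C X = Id C X" "Id C Y \<cdot> Id C Y = Id C Y" "Id C Z \<cdot> Id C Z = Id C Z"
    "f \<cdot> Id C X = f" "Id C Y \<cdot> f = f" "n \<cdot> Id C Z = n" "Id C Y \<cdot> n = n"
    using idH f n comp_id id_comp by blast+
  have "is_functor cospan C F D"
    unfolding is_functor_def by (simp add: cospan_simps D_simps F_simps O f n idH unit)
  moreover have "finite (Obj cospan)" "finite (Arr cospan)" by (simp_all add: cospan_def)
  ultimately obtain L \<pi> where L: "is_limit cospan C F D L \<pi>"
    using finitely_complete category_cospan unfolding finitely_complete_def by blast
  have cone_iff: "is_cone cospan C F D K \<kappa> \<longleftrightarrow> \<kappa> 0 \<in> Hom C K X \<and> \<kappa> 1 \<in> Hom C K Z \<and>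
      f \<cdot> \<kappa> 0 = \<kappa> 2 \<and> n \<cdot> \<kappa> 1 = \<kappa> 2" for K \<kappa>
  proof -
    have "K \<in> Obj C" if "\<kappa> 0 \<in> Hom C K X"
      using dom_obj homD that by metis
    moreover have "\<kappa> 2 \<in> Hom C K Y" if "\<kappa> 0 \<in> Hom C K X" "f \<cdot> \<kappa> 0 = \<kappa> 2"
      using comp_hom[OF that(1) f] that(2) by simp
    moreover have "Id C X \<cdot> \<kappa> 0 = \<kappa> 0" if "\<kappa> 0 \<in> Hom C K X" using that id_comp by blast
    moreover have "Id C Z \<cdot> \<kappa> 1 = \<kappa> 1" if "\<kappa> 1 \<in> Hom C K Z" using that id_comp by blast
    moreover have "Id C Y \<cdot> \<kappa> 2 = \<kappa> 2" if "\<kappa> 2 \<in> Hom C K Y" using that id_comp by blast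
    ultimately show ?thesis
      unfolding is_cone_def by (simp add: cospan_simps D_simps F_simps) blast
  qed
  have \<pi>: "\<pi> 0 \<in> Hom C L X" "\<pi> 1 \<in> Hom C L Z" "f \<cdot> \<pi> 0 = \<pi> 2" "n \<cdot> \<pi> 1 = \<pi> 2"
    using L cone_iff unfolding is_limit_def by blast+
  have "\<exists>!u. u \<in> Hom C W L \<and> \<pi> 0 \<cdot> u = a \<and> \<pi> 1 \<cdot> u = b"
    if a: "a \<in> Hom C W X" and b: "b \<in> Hom C W Z" and e: "f \<cdot> a = n \<cdot> b" for W a b
  proof -
    define \<kappa> where "\<kappa> i = (if i = 0 then a else if i = 1 then b else f \<cdot> a)" for i :: nat
    have "is_cone cospan C F D W \<kappa>" using a b e by (simp add: cone_iff \<kappa>_def)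
    then have "\<exists>!u. u \<in> Hom C W L \<and> (\<forall>i \<in> Obj cospan. \<pi> i \<cdot> u = \<kappa> i)"
      using L unfolding is_limit_def by blast
    moreover have "(\<forall>i \<in> Obj cospan. \<pi> i \<cdot> u = \<kappa> i) \<longleftrightarrow> \<pi> 0 \<cdot> u = a \<and> \<pi> 1 \<cdot> u = b"
      if "u \<in> Hom C W L" for u
      using comp_assoc[OF that \<pi>(1) f] \<pi>(3)
      by (auto simp: cospan_simps \<kappa>_def)
    ultimately show ?thesis by metis
  qed
  then have "is_pullback C f n (\<pi> 0) (\<pi> 1)"
    unfolding is_pullback_def using \<pi> f n by (auto simp: Hom_def)
  then show ?thesis by blast
qed

lemma initial_exists: obtains I where "is_initial C I"
proof -
  obtain S \<iota> where "is_coproduct C ({} :: nat set) (\<lambda>_. undefined) S \<iota>"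
    using has_finite_coproducts unfolding has_finite_coproducts_def by blast
  then have "is_initial C S" unfolding is_coproduct_def is_initial_def by auto
  then show ?thesis by (rule that)
qed


section \<open>Admissible subobjects\<close>

abbreviation sub :: "'o \<Rightarrow> 'a set set"
  where "sub X \<equiv> carrier (Sub C M X)"

abbreviation below :: "'o \<Rightarrow> 'a set \<Rightarrow> 'a set \<Rightarrow> bool"
  where "below X p q \<equiv> p \<sqsubseteq>\<^bsub>Sub C M X\<^esub> q"

abbreviation bot_sub :: "'o \<Rightarrow> 'a set"
  where "bot_sub X \<equiv> smallest_sub C E M X"

definition subobject :: "'a \<Rightarrow> 'a set"
  where "subobject m = {n \<in> M. Cod C n = Cod C m \<and> factors_through C m n \<and> factors_through C n m}"

text \<open>The generalised elements of a subobject. They determine the subobject and its place in the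
  order (\<open>below_iff\<close>), and they turn preimages and direct images into statements about composites
  in which no representative has to be chosen.\<close>

definition lies_in :: "'a \<Rightarrow> 'a set \<Rightarrow> bool"
  where "lies_in g p \<longleftrightarrow> (\<exists>n \<in> p. factors_through C g n)"

lemma sub_iff: "p \<in> sub X \<longleftrightarrow> (\<exists>m \<in> M. Cod C m = X \<and> p = subobject m)"
proof -
  have "sub_equiv C M X `` {m} = subobject m" if "m \<in> M" "Cod C m = X" for m
    using that by (auto simp: sub_equiv_def admissible_def subobject_def)
  then show ?thesis
    by (auto simp: Sub_def quotient_def admissible_def)
qed

lemma sub_mem:
  assumes "p \<in> sub X" "m \<in> p"
  shows "m \<in> M" "Cod C m = X"
  using assms by (auto simp: sub_iff subobject_def)

lemma subobject_sub: "m \<in> M \<Longrightarrow> subobject m \<in> sub (Cod C m)"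
  by (auto simp: sub_iff)

lemma subobject_self: "m \<in> M \<Longrightarrow> m \<in> subobject m"
  by (simp add: subobject_def factors_through_refl M_arr)

lemma sub_nonempty: "p \<in> sub X \<Longrightarrow> \<exists>m. m \<in> p"
  using sub_iff subobject_self by blast

lemma sub_obj: "p \<in> sub X \<Longrightarrow> X \<in> Obj C"
  using sub_iff M_arr cod_obj by auto

lemma lies_in_iff:
  assumes "p \<in> sub X" "n \<in> p"
  shows "lies_in g p \<longleftrightarrow> factors_through C g n"
proof
  assume "lies_in g p"
  then obtain k where k: "k \<in> p" "factors_through C g k" by (auto simp: lies_in_def)
  obtain m where m: "m \<in> M" "p = subobject m" using assms(1) sub_iff by auto
  have "factors_through C k m" "factors_through C m n" "m \<in> Arr C" "n \<in> Arr C"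
    using k(1) assms(2) m M_arr by (auto simp: subobject_def)
  then show "factors_through C g n"
    using k(2) factors_through_trans by blast
qed (use assms in \<open>auto simp: lies_in_def\<close>)

lemma lies_in_subobject: "m \<in> M \<Longrightarrow> lies_in g (subobject m) \<longleftrightarrow> factors_through C g m"
  using lies_in_iff subobject_sub subobject_self by blast

lemma lies_in_hom:
  assumes "p \<in> sub X" "lies_in g p"
  shows "g \<in> Hom C (Dom C g) X"
proof -
  obtain n where n: "n \<in> p" "factors_through C g n" using assms(2) by (auto simp: lies_in_def)
  have "n \<in> Arr C" "Cod C n = X" using sub_mem[OF assms(1) n(1)] M_arr by auto
  then show ?thesis using factors_through_cod[OF n(2)] by (simp add: Hom_def)
qed

lemma lies_in_comp:
  assumes "p \<in> sub X" "lies_in g p" "k \<in> Hom C W (Dom C g)"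
  shows "lies_in (g \<cdot> k) p"
proof -
  obtain n where n: "n \<in> p" "factors_through C g n" using assms(2) by (auto simp: lies_in_def)
  have "n \<in> Arr C" using sub_mem[OF assms(1) n(1)] M_arr by auto
  then have "factors_through C (g \<cdot> k) n" using factors_through_comp n(2) assms(3) by blast
  then show ?thesis using n(1) by (auto simp: lies_in_def)
qed

lemma lies_in_self:
  assumes "p \<in> sub X" "m \<in> p"
  shows "lies_in m p"
  using factors_through_refl[OF M_arr[OF sub_mem(1)[OF assms]]] assms(2) by (auto simp: lies_in_def)

lemma below_iff_rep:
  assumes "p \<in> sub X" "q \<in> sub X" "m \<in> p"
  shows "below X p q \<longleftrightarrow> lies_in m q"
proof
  assume "below X p q"
  then obtain k n where kn: "k \<in> p" "n \<in> q" "factors_through C k n" by (auto simp: Sub_def)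
  have "factors_through C m k"
    using lies_in_iff[OF assms(1) kn(1)] lies_in_self[OF assms(1,3)] by simp
  moreover have "n \<in> Arr C" using sub_mem[OF assms(2) kn(2)] M_arr by blast
  ultimately show "lies_in m q" using kn factors_through_trans unfolding lies_in_def by blast
next
  assume "lies_in m q"
  then show "below X p q" using assms(3) by (auto simp: Sub_def lies_in_def)
qed

lemma below_iff:
  assumes "p \<in> sub X" "q \<in> sub X"
  shows "below X p q \<longleftrightarrow> (\<forall>g. lies_in g p \<longrightarrow> lies_in g q)"
proof -
  obtain m where m: "m \<in> p" using sub_nonempty[OF assms(1)] by blast
  have "lies_in g q" if mq: "lies_in m q" and gp: "lies_in g p" for g
  proof -
    obtain k where k: "k \<in> Hom C (Dom C g) (Dom C m)" "g = m \<cdot> k"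
      using gp lies_in_iff[OF assms(1) m] by (auto simp: factors_through_def)
    then show ?thesis using lies_in_comp[OF assms(2) mq] by blast
  qed
  then show ?thesis
    using below_iff_rep[OF assms m] lies_in_self[OF assms(1) m] by blast
qed

lemma complete_lattice_sub: "p \<in> sub X \<Longrightarrow> complete_lattice (Sub C M X)"
  using complete_lattice_Sub sub_obj by blast

lemma below_refl: "p \<in> sub X \<Longrightarrow> below X p p"
  by (simp add: below_iff)

lemma below_trans:
  "\<lbrakk>below X p q; below X q r; p \<in> sub X; q \<in> sub X; r \<in> sub X\<rbrakk> \<Longrightarrow> below X p r"
  by (simp add: below_iff)

lemma below_antisym:
  assumes "below X p q" "below X q p" "p \<in> sub X" "q \<in> sub X"
  shows "p = q"
proof -
  interpret complete_lattice "Sub C M X" using assms complete_lattice_sub by blast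
  show ?thesis using assms le_antisym by blast
qed

lemma sub_eqI:
  assumes "p \<in> sub X" "q \<in> sub X" "\<And>g. g \<in> Hom C (Dom C g) X \<Longrightarrow> lies_in g p \<longleftrightarrow> lies_in g q"
  shows "p = q"
proof (rule below_antisym)
  show "below X p q" "below X q p"
    using assms(3) lies_in_hom[OF assms(1)] lies_in_hom[OF assms(2)]
    unfolding below_iff[OF assms(1,2)] below_iff[OF assms(2,1)] by blast+
qed (use assms in auto)

lemma sub_eq_if_common:
  assumes "p \<in> sub X" "q \<in> sub X" "m \<in> p" "m \<in> q"
  shows "p = q"
  using sub_eqI[OF assms(1,2)] lies_in_iff[OF assms(1,3)] lies_in_iff[OF assms(2,4)] by blast

lemma strictly_below_iff: "p \<sqsubset>\<^bsub>Sub C M X\<^esub> q \<longleftrightarrow> below X p q \<and> p \<noteq> q"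
  by (simp add: lless_def) (simp add: Sub_def)

lemma Inf_sub:
  assumes "X \<in> Obj C" "S \<subseteq> sub X"
  shows "\<Sqinter>\<^bsub>Sub C M X\<^esub> S \<in> sub X"
    and "p \<in> S \<Longrightarrow> below X (\<Sqinter>\<^bsub>Sub C M X\<^esub> S) p"
    and "\<lbrakk>q \<in> sub X; \<And>p. p \<in> S \<Longrightarrow> below X q p\<rbrakk> \<Longrightarrow> below X q (\<Sqinter>\<^bsub>Sub C M X\<^esub> S)"
proof -
  interpret complete_lattice "Sub C M X" using assms complete_lattice_Sub by blast
  show "\<Sqinter>\<^bsub>Sub C M X\<^esub> S \<in> sub X" using assms by simp
  show "p \<in> S \<Longrightarrow> below X (\<Sqinter>\<^bsub>Sub C M X\<^esub> S) p" using assms inf_lower by blast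
  show "\<lbrakk>q \<in> sub X; \<And>p. p \<in> S \<Longrightarrow> below X q p\<rbrakk> \<Longrightarrow> below X q (\<Sqinter>\<^bsub>Sub C M X\<^esub> S)"
    using assms inf_greatest by blast
qed

lemma Sup_sub:
  assumes "X \<in> Obj C" "S \<subseteq> sub X"
  shows "\<Squnion>\<^bsub>Sub C M X\<^esub> S \<in> sub X"
    and "p \<in> S \<Longrightarrow> below X p (\<Squnion>\<^bsub>Sub C M X\<^esub> S)"
    and "\<lbrakk>q \<in> sub X; \<And>p. p \<in> S \<Longrightarrow> below X p q\<rbrakk> \<Longrightarrow> below X (\<Squnion>\<^bsub>Sub C M X\<^esub> S) q"
proof -
  interpret complete_lattice "Sub C M X" using assms complete_lattice_Sub by blast
  show "\<Squnion>\<^bsub>Sub C M X\<^esub> S \<in> sub X" using assms by simp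
  show "p \<in> S \<Longrightarrow> below X p (\<Squnion>\<^bsub>Sub C M X\<^esub> S)" using assms sup_upper by blast
  show "\<lbrakk>q \<in> sub X; \<And>p. p \<in> S \<Longrightarrow> below X p q\<rbrakk> \<Longrightarrow> below X (\<Squnion>\<^bsub>Sub C M X\<^esub> S) q"
    using assms sup_least by blast
qed

lemma meet_sub:
  assumes "p \<in> sub X" "q \<in> sub X"
  shows "p \<sqinter>\<^bsub>Sub C M X\<^esub> q \<in> sub X"
    and "below X (p \<sqinter>\<^bsub>Sub C M X\<^esub> q) p" and "below X (p \<sqinter>\<^bsub>Sub C M X\<^esub> q) q"
    and "\<lbrakk>r \<in> sub X; below X r p; below X r q\<rbrakk> \<Longrightarrow> below X r (p \<sqinter>\<^bsub>Sub C M X\<^esub> q)"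
proof -
  have X: "X \<in> Obj C" and S: "{p, q} \<subseteq> sub X" using assms sub_obj by auto
  note Inf = Inf_sub[OF X S]
  show "p \<sqinter>\<^bsub>Sub C M X\<^esub> q \<in> sub X" "below X (p \<sqinter>\<^bsub>Sub C M X\<^esub> q) p" "below X (p \<sqinter>\<^bsub>Sub C M X\<^esub> q) q"
    unfolding meet_def using Inf(1) Inf(2)[of p] Inf(2)[of q] by simp_all
  show "\<lbrakk>r \<in> sub X; below X r p; below X r q\<rbrakk> \<Longrightarrow> below X r (p \<sqinter>\<^bsub>Sub C M X\<^esub> q)"
    unfolding meet_def using Inf(3)[of r] by blast
qed

lemma factors_through_iso:
  assumes "m \<in> M" "n \<in> M" "factors_through C m n" "factors_through C n m"
  obtains k where "k \<in> Hom C (Dom C m) (Dom C n)" "m = n \<cdot> k" "is_isomorphism C k"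
proof -
  obtain k where k: "k \<in> Hom C (Dom C m) (Dom C n)" "m = n \<cdot> k"
    using assms(3) unfolding factors_through_def by blast
  obtain l where l: "l \<in> Hom C (Dom C n) (Dom C m)" "n = m \<cdot> l"
    using assms(4) unfolding factors_through_def by blast
  have m: "m \<in> Hom C (Dom C m) (Cod C m)" and n: "n \<in> Hom C (Dom C n) (Cod C n)"
    using assms M_hom by auto
  have idm: "Id C (Dom C m) \<in> Hom C (Dom C m) (Dom C m)"
    and idn: "Id C (Dom C n) \<in> Hom C (Dom C n) (Dom C n)"
    using assms M_arr dom_obj id_hom by auto
  have "m \<cdot> (l \<cdot> k) = m \<cdot> Id C (Dom C m)"
    using comp_assoc[OF k(1) l(1) m] comp_id[OF m] k(2)[symmetric] l(2)[symmetric] by simp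
  then have lk: "l \<cdot> k = Id C (Dom C m)"
    using mono_cancel[OF M_mono[OF assms(1)] comp_hom[OF k(1) l(1)] idm] by blast
  have "n \<cdot> (k \<cdot> l) = n \<cdot> Id C (Dom C n)"
    using comp_assoc[OF l(1) k(1) n] comp_id[OF n] k(2)[symmetric] l(2)[symmetric] by simp
  then have kl: "k \<cdot> l = Id C (Dom C n)"
    using mono_cancel[OF M_mono[OF assms(2)] comp_hom[OF l(1) k(1)] idn] by blast
  have "is_isomorphism C k"
    unfolding is_isomorphism_def using lk kl l(1) homD[OF k(1)] by auto
  then show ?thesis using k that by blast
qed

text \<open>The image is the \<open>M\<close>-part of the factorization of \<open>f\<close>; the diagonal fill-in is what makes it the least
  admissible subobject through which \<open>f\<close> factors.\<close>

lemma image_exists: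
  assumes f: "f \<in> Hom C X Y"
  obtains i where "i \<in> sub Y" "\<And>p. p \<in> sub Y \<Longrightarrow> lies_in f p \<longleftrightarrow> below Y i p"
proof -
  obtain e m where em: "e \<in> E" "m \<in> M" "Cod C e = Dom C m" "f = m \<cdot> e"
    using factorize homD(1)[OF f] by blast
  have e: "e \<in> Hom C (Dom C e) (Dom C m)" and m: "m \<in> Hom C (Dom C m) (Cod C m)"
    using em hom_self[OF E_arr[OF em(1)]] M_hom by auto
  have D: "Dom C e = X" "Cod C m = Y" using comp_hom[OF e m] em(4) f homD by metis+
  have "lies_in f p \<longleftrightarrow> below Y (subobject m) p" if p: "p \<in> sub Y" for p
  proof -
    obtain n where n: "n \<in> p" using sub_nonempty[OF p] by blast
    have nM: "n \<in> M" "Cod C n = Y" using sub_mem[OF p n] by auto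
    have "factors_through C m n" if fn: "factors_through C f n"
    proof -
      obtain k where k: "k \<in> Hom C X (Dom C n)" "f = n \<cdot> k"
        using fn homD[OF f] by (auto simp: factors_through_def)
      obtain d where "d \<in> Hom C (Cod C e) (Dom C n)" "n \<cdot> d = m"
        using fill_in[OF em(1) nM(1), of k m] k D m nM(2) em(3,4) by auto
      then show ?thesis using em(3) by (auto simp: factors_through_def)
    qed
    moreover have "factors_through C f n" if "factors_through C m n"
      using factors_through_comp[OF that M_arr[OF nM(1)] e] em(4) by simp
    moreover have "below Y (subobject m) p \<longleftrightarrow> lies_in m p"
      using below_iff_rep[OF _ p, of "subobject m" m] subobject_sub[OF em(2)] subobject_self[OF em(2)] D
      by simp
    ultimately show ?thesis using lies_in_iff[OF p n] by blast
  qed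
  then show ?thesis using that[of "subobject m"] subobject_sub[OF em(2)] D by simp
qed

section \<open>Preimages\<close>

text \<open>All pullbacks of all representatives of \<open>p\<close> are admissible and have the same generalised
  elements, so they form exactly one equivalence class.\<close>

lemma preimage_props:
  assumes f: "f \<in> Hom C X Y" and p: "p \<in> sub Y"
  shows preimage_sub: "preimage C f p \<in> sub X"
    and lies_in_preimage: "g \<in> Hom C W X \<Longrightarrow> lies_in g (preimage C f p) \<longleftrightarrow> lies_in (f \<cdot> g) p"
proof -
  obtain n where n: "n \<in> p" using sub_nonempty[OF p] by blast
  have nM: "n \<in> M" "Cod C n = Y" using sub_mem[OF p n] by auto
  obtain a q where aq: "is_pullback C f n a q"
    using pullback_exists[OF f] M_hom[OF nM(1)] nM(2) by blast
  have pb: "a' \<in> M \<and> Cod C a' = X \<and>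
      (\<forall>W. \<forall>g \<in> Hom C W X. factors_through C g a' \<longleftrightarrow> lies_in (f \<cdot> g) p)"
    if "is_pullback C f n' a' q'" "n' \<in> p" for n' a' q'
  proof (intro conjI allI ballI)
    show "a' \<in> M" using M_pullback[OF that(1)] sub_mem[OF p that(2)] by blast
    show "Cod C a' = X" using that(1) homD[OF f] by (auto simp: is_pullback_def Hom_def)
    fix W g assume "g \<in> Hom C W X"
    then show "factors_through C g a' \<longleftrightarrow> lies_in (f \<cdot> g) p"
      using pullback_factors_through[OF that(1)] homD[OF f] lies_in_iff[OF p that(2)] by blast
  qed
  have a: "a \<in> M" "Cod C a = X"
    and ag: "\<And>W g. g \<in> Hom C W X \<Longrightarrow> factors_through C g a \<longleftrightarrow> lies_in (f \<cdot> g) p"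
    using pb[OF aq n] by auto
  have "preimage C f p = subobject a"
  proof (intro subset_antisym subsetI)
    fix a' assume "a' \<in> preimage C f p"
    then obtain n' q' where 1: "n' \<in> p" "is_pullback C f n' a' q'" by (auto simp: preimage_def)
    note a' = pb[OF 1(2,1)]
    have H: "a \<in> Hom C (Dom C a) X" "a' \<in> Hom C (Dom C a') X"
      using a a' M_hom[of a] M_hom[of a'] by simp_all
    have "factors_through C a a'" "factors_through C a' a"
      using a' ag[OF H(1)] ag[OF H(2)] H factors_through_refl homD(1) by meson+
    then show "a' \<in> subobject a" using a a' by (simp add: subobject_def)
  next
    fix a' assume "a' \<in> subobject a"
    then have a': "a' \<in> M" "Cod C a' = X" "factors_through C a a'" "factors_through C a' a"
      using a by (auto simp: subobject_def)
    have "factors_through C g a' \<longleftrightarrow> factors_through C (f \<cdot> g) n" if "g \<in> Hom C W X" for W g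
      using ag[OF that] lies_in_iff[OF p n] factors_through_trans a' a M_arr by blast
    then have "\<exists>q. is_pullback C f n a' q"
      using pullbackI[OF f M_mono[OF nM(1)] nM(2) M_mono[OF a'(1)] a'(2)] by blast
    then show "a' \<in> preimage C f p" using n by (auto simp: preimage_def)
  qed
  then show "preimage C f p \<in> sub X"
    "g \<in> Hom C W X \<Longrightarrow> lies_in g (preimage C f p) \<longleftrightarrow> lies_in (f \<cdot> g) p"
    using subobject_sub[OF a(1)] a(2) lies_in_subobject[OF a(1)] ag by auto
qed

lemma preimage_mono:
  assumes f: "f \<in> Hom C X Y" and pq: "p \<in> sub Y" "q \<in> sub Y" "below Y p q"
  shows "below X (preimage C f p) (preimage C f q)"
  unfolding below_iff[OF preimage_sub[OF f pq(1)] preimage_sub[OF f pq(2)]]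
proof (intro allI impI)
  fix g assume g: "lies_in g (preimage C f p)"
  note gH = lies_in_hom[OF preimage_sub[OF f pq(1)] g]
  have "lies_in (f \<cdot> g) p" using g lies_in_preimage[OF f pq(1) gH] by simp
  then have "lies_in (f \<cdot> g) q" using pq(3) below_iff[OF pq(1,2)] by blast
  then show "lies_in g (preimage C f q)" using lies_in_preimage[OF f pq(2) gH] by simp
qed

lemma preimage_comp:
  assumes f: "f \<in> Hom C X Y" and g: "g \<in> Hom C Y Z" and p: "p \<in> sub Z"
  shows "preimage C (g \<cdot> f) p = preimage C f (preimage C g p)"
proof (rule sub_eqI)
  show "preimage C (g \<cdot> f) p \<in> sub X" using preimage_sub[OF comp_hom[OF f g] p] .
  show "preimage C f (preimage C g p) \<in> sub X" using preimage_sub[OF f preimage_sub[OF g p]] .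
  fix h assume h: "h \<in> Hom C (Dom C h) X"
  show "lies_in h (preimage C (g \<cdot> f) p) \<longleftrightarrow> lies_in h (preimage C f (preimage C g p))"
    using lies_in_preimage[OF comp_hom[OF f g] p h] lies_in_preimage[OF f preimage_sub[OF g p] h]
      lies_in_preimage[OF g p comp_hom[OF h f]] comp_assoc[OF h f g] by simp
qed

section \<open>Direct images along admissible monomorphisms\<close>

definition direct_image :: "'a \<Rightarrow> 'a set \<Rightarrow> 'a set"
  where "direct_image m u = (\<Union>k \<in> u. subobject (m \<cdot> k))"

lemma direct_image_props:
  assumes m: "m \<in> M" and u: "u \<in> sub (Dom C m)"
  shows direct_image_sub: "direct_image m u \<in> sub (Cod C m)"
    and lies_in_direct_image: "lies_in g (direct_image m u) \<longleftrightarrow> (\<exists>k. lies_in k u \<and> g = m \<cdot> k)"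
    and comp_in_direct_image: "k \<in> u \<Longrightarrow> m \<cdot> k \<in> direct_image m u"
proof -
  have mH: "m \<in> Hom C (Dom C m) (Cod C m)" using M_hom[OF m] .
  have mk: "m \<cdot> k \<in> M" "Cod C (m \<cdot> k) = Cod C m" "Dom C (m \<cdot> k) = Dom C k"
    "k \<in> Hom C (Dom C k) (Dom C m)" if "k \<in> u" for k
  proof -
    show k: "k \<in> Hom C (Dom C k) (Dom C m)" using sub_mem[OF u that] M_hom by metis
    show "m \<cdot> k \<in> M" using M_comp[OF m] sub_mem[OF u that] by blast
    show "Cod C (m \<cdot> k) = Cod C m" "Dom C (m \<cdot> k) = Dom C k"
      using homD[OF comp_hom[OF k mH]] by auto
  qed
  have char: "lies_in g (subobject (m \<cdot> k)) \<longleftrightarrow> (\<exists>b. lies_in b u \<and> g = m \<cdot> b)" if k: "k \<in> u" for g k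
  proof -
    have "factors_through C g (m \<cdot> k) \<longleftrightarrow> (\<exists>b. lies_in b u \<and> g = m \<cdot> b)"
    proof
      assume "factors_through C g (m \<cdot> k)"
      then obtain a where a: "a \<in> Hom C (Dom C g) (Dom C k)" "g = (m \<cdot> k) \<cdot> a"
        using mk[OF k] by (auto simp: factors_through_def)
      then show "\<exists>b. lies_in b u \<and> g = m \<cdot> b"
        using comp_assoc[OF a(1) mk(4)[OF k] mH] lies_in_comp[OF u lies_in_self[OF u k] a(1)] by auto
    next
      assume "\<exists>b. lies_in b u \<and> g = m \<cdot> b"
      then obtain b where b: "lies_in b u" "g = m \<cdot> b" by blast
      obtain a where a: "a \<in> Hom C (Dom C b) (Dom C k)" "b = k \<cdot> a"
        using b(1) lies_in_iff[OF u k] by (auto simp: factors_through_def)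
      have "Dom C g = Dom C b" using homD[OF comp_hom[OF lies_in_hom[OF u b(1)] mH]] b(2) by simp
      moreover have "g = (m \<cdot> k) \<cdot> a" using comp_assoc[OF a(1) mk(4)[OF k] mH] a b by simp
      ultimately show "factors_through C g (m \<cdot> k)"
        using a(1) mk[OF k] by (auto simp: factors_through_def)
    qed
    then show ?thesis using lies_in_subobject[OF mk(1)[OF k]] by simp
  qed
  obtain k0 where k0: "k0 \<in> u" using sub_nonempty[OF u] by blast
  have S: "subobject (m \<cdot> k) \<in> sub (Cod C m)" if "k \<in> u" for k
    using subobject_sub[OF mk(1)[OF that]] mk(2)[OF that] by simp
  have "subobject (m \<cdot> k) = subobject (m \<cdot> k0)" if "k \<in> u" for k
    using sub_eqI[OF S[OF that] S[OF k0]] char[OF that] char[OF k0] by blast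
  then have eq: "direct_image m u = subobject (m \<cdot> k0)"
    using k0 unfolding direct_image_def by blast
  show "direct_image m u \<in> sub (Cod C m)" using S[OF k0] eq by simp
  show "lies_in g (direct_image m u) \<longleftrightarrow> (\<exists>k. lies_in k u \<and> g = m \<cdot> k)"
    using char[OF k0] eq by simp
  show "k \<in> u \<Longrightarrow> m \<cdot> k \<in> direct_image m u"
    using subobject_self[OF mk(1)] unfolding direct_image_def by blast
qed

lemma direct_image_below_iff:
  assumes m: "m \<in> M" and u: "u \<in> sub (Dom C m)" and t: "t \<in> sub (Cod C m)"
  shows "below (Cod C m) (direct_image m u) t \<longleftrightarrow> below (Dom C m) u (preimage C m t)"
proof -
  have "lies_in k (preimage C m t) \<longleftrightarrow> lies_in (m \<cdot> k) t" if "lies_in k u" for k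
    using lies_in_preimage[OF M_hom[OF m] t lies_in_hom[OF u that]] .
  then show ?thesis
    unfolding below_iff[OF direct_image_sub[OF m u] t] lies_in_direct_image[OF m u]
      below_iff[OF u preimage_sub[OF M_hom[OF m] t]]
    by blast
qed

text \<open>This is where \<open>m\<close> being a monomorphism enters: a generalised element of the direct image comes
  from only one arrow into the domain of \<open>m\<close>.\<close>

lemma preimage_direct_image:
  assumes m: "m \<in> M" and u: "u \<in> sub (Dom C m)"
  shows "preimage C m (direct_image m u) = u"
proof (rule sub_eqI)
  show "preimage C m (direct_image m u) \<in> sub (Dom C m)"
    using preimage_sub[OF M_hom[OF m] direct_image_sub[OF m u]] .
  fix g assume g: "g \<in> Hom C (Dom C g) (Dom C m)"
  have "g = k" if k: "lies_in k u" "m \<cdot> g = m \<cdot> k" for k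
  proof -
    have mH: "m \<in> Hom C (Dom C m) (Cod C m)" using M_hom[OF m] .
    have kH: "k \<in> Hom C (Dom C k) (Dom C m)" using lies_in_hom[OF u k(1)] .
    have "Dom C k = Dom C g"
      using homD(2)[OF comp_hom[OF kH mH]] homD(2)[OF comp_hom[OF g mH]] k(2) by simp
    then show ?thesis using mono_cancel[OF M_mono[OF m] g] kH k(2) by simp
  qed
  then show "lies_in g (preimage C m (direct_image m u)) \<longleftrightarrow> lies_in g u"
    using lies_in_preimage[OF M_hom[OF m] direct_image_sub[OF m u] g] lies_in_direct_image[OF m u]
    by blast
qed (rule u)

lemma direct_image_order_embedding:
  assumes m: "m \<in> M" and u: "u \<in> sub (Dom C m)" and v: "v \<in> sub (Dom C m)"
  shows "below (Cod C m) (direct_image m u) (direct_image m v) \<longleftrightarrow> below (Dom C m) u v"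
  using direct_image_below_iff[OF m u direct_image_sub[OF m v]] preimage_direct_image[OF m v] by simp

lemma direct_image_below:
  assumes m: "m \<in> M" and u: "u \<in> sub (Dom C m)"
  shows "below (Cod C m) (direct_image m u) (subobject m)"
  unfolding below_iff[OF direct_image_sub[OF m u] subobject_sub[OF m]] lies_in_direct_image[OF m u]
    lies_in_subobject[OF m]
proof (intro allI impI)
  fix g assume "\<exists>k. lies_in k u \<and> g = m \<cdot> k"
  then obtain k where k: "lies_in k u" "g = m \<cdot> k" by blast
  show "factors_through C g m"
    using factors_through_comp[OF factors_through_refl M_arr[OF m] lies_in_hom[OF u k(1)]] k(2)
      M_arr[OF m] by simp
qed

lemma direct_image_preimage:
  assumes m: "m \<in> M" and x: "x \<in> sub (Cod C m)" and le: "below (Cod C m) x (subobject m)"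
  shows "direct_image m (preimage C m x) = x"
proof (rule sub_eqI)
  have mH: "m \<in> Hom C (Dom C m) (Cod C m)" using M_hom[OF m] .
  have px: "preimage C m x \<in> sub (Dom C m)" using preimage_sub[OF mH x] .
  show "direct_image m (preimage C m x) \<in> sub (Cod C m)" using direct_image_sub[OF m px] .
  fix g
  have "\<exists>k. k \<in> Hom C (Dom C g) (Dom C m) \<and> g = m \<cdot> k" if "lies_in g x"
    using le that lies_in_subobject[OF m]
    unfolding below_iff[OF x subobject_sub[OF m]] factors_through_def by blast
  then show "lies_in g (direct_image m (preimage C m x)) \<longleftrightarrow> lies_in g x"
    unfolding lies_in_direct_image[OF m px]
    using lies_in_hom[OF px] lies_in_preimage[OF mH x] by metis
qed (rule x)

section \<open>The smallest subobject\<close>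

text \<open>The two arrows from the initial object to \<open>X\<close>, through \<open>m\<close> and through \<open>n\<close>, agree, and the
  resulting square has a diagonal.\<close>

lemma smallest_sub_minimal:
  assumes "m \<in> smallest_sub C E M X" "n \<in> M" "Cod C n = X"
  shows "factors_through C m n"
proof -
  obtain I e where m: "m \<in> M" "Cod C m = X" and I: "is_initial C I" and e: "e \<in> E"
    "e \<in> Hom C I (Dom C m)"
    using assms(1) by (auto simp: smallest_sub_def admissible_def)
  have mH: "m \<in> Hom C (Dom C m) X" and nH: "n \<in> Hom C (Dom C n) X"
    using M_hom[OF m(1)] m(2) M_hom[OF assms(2)] assms(3) by simp_all
  have initial: "\<exists>!t. t \<in> Hom C I Z" if "Z \<in> Obj C" for Z
    using I that by (simp add: is_initial_def)
  obtain k where k: "k \<in> Hom C I (Dom C n)"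
    using initial[OF dom_obj[OF M_arr[OF assms(2)]]] by blast
  have "X \<in> Obj C" using m M_arr cod_obj by blast
  then have "m \<cdot> e = n \<cdot> k"
    using initial comp_hom[OF e(2) mH] comp_hom[OF k nH] by blast
  then obtain d where "d \<in> Hom C (Cod C e) (Dom C n)" "n \<cdot> d = m"
    using fill_in[OF e(1) assms(2), of k m] k mH assms(3) homD[OF e(2)] by auto
  then show ?thesis using homD[OF e(2)] by (auto simp: factors_through_def)
qed

lemma smallest_sub_props:
  assumes X: "X \<in> Obj C"
  shows bot_sub: "bot_sub X \<in> sub X"
    and bot_below: "p \<in> sub X \<Longrightarrow> below X (bot_sub X) p"
proof -
  obtain I where I: "is_initial C I" using initial_exists .
  then obtain t where t: "t \<in> Hom C I X" using X unfolding is_initial_def by blast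
  obtain e s where es: "e \<in> E" "s \<in> M" "Cod C e = Dom C s" "t = s \<cdot> e"
    using factorize homD(1)[OF t] by blast
  have eH: "e \<in> Hom C (Dom C e) (Dom C s)" using es hom_self[OF E_arr[OF es(1)]] by simp
  have D: "Dom C e = I" "Cod C s = X"
    using comp_hom[OF eH M_hom[OF es(2)]] es(4) t homD by metis+
  have s: "s \<in> smallest_sub C E M X"
    unfolding smallest_sub_def admissible_def using es D I eH by auto
  have eq: "smallest_sub C E M X = subobject s"
  proof (intro subset_antisym subsetI)
    fix m assume m: "m \<in> smallest_sub C E M X"
    then have "m \<in> M" "Cod C m = X" by (auto simp: smallest_sub_def admissible_def)
    then show "m \<in> subobject s"
      using smallest_sub_minimal[OF m es(2) D(2)] smallest_sub_minimal[OF s, of m] D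
      by (auto simp: subobject_def)
  next
    fix m assume "m \<in> subobject s"
    then have m: "m \<in> M" "Cod C m = X" "factors_through C s m" "factors_through C m s"
      using D by (auto simp: subobject_def)
    obtain l where l: "l \<in> Hom C (Dom C s) (Dom C m)" "is_isomorphism C l"
      using factors_through_iso[OF es(2) m(1,3,4)] by blast
    have "l \<cdot> e \<in> E"
      using factorization_system l(2) homD[OF l(1)] es(1,3) unfolding factorization_system_def
      by simp
    moreover have "l \<cdot> e \<in> Hom C I (Dom C m)" using comp_hom[OF eH l(1)] D by simp
    ultimately show "m \<in> smallest_sub C E M X"
      unfolding smallest_sub_def admissible_def using m I by blast
  qed
  show S: "bot_sub X \<in> sub X" using eq subobject_sub[OF es(2)] D by simp
  show "below X (bot_sub X) p" if p: "p \<in> sub X"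
  proof -
    obtain n where n: "n \<in> p" using sub_nonempty[OF p] by blast
    have "factors_through C s n" using smallest_sub_minimal[OF s] sub_mem[OF p n] by blast
    then show ?thesis using below_iff_rep[OF S p s] lies_in_iff[OF p n] by blast
  qed
qed

text \<open>Composing the representative \<open>s\<close> of the smallest subobject with \<open>m\<close> leaves the \<open>E\<close>-arrow from
  the initial object to its domain untouched.\<close>

lemma direct_image_bot:
  assumes m: "m \<in> M"
  shows "direct_image m (bot_sub (Dom C m)) = bot_sub (Cod C m)"
proof -
  have O: "Dom C m \<in> Obj C" "Cod C m \<in> Obj C" using m M_arr dom_obj cod_obj by auto
  obtain s where s: "s \<in> bot_sub (Dom C m)" using sub_nonempty[OF bot_sub[OF O(1)]] by blast
  obtain I e where I: "is_initial C I" "e \<in> E" "e \<in> Hom C I (Dom C s)" and sM: "s \<in> M" "Cod C s = Dom C m"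
    using s by (auto simp: smallest_sub_def admissible_def)
  have H: "m \<cdot> s \<in> Hom C (Dom C s) (Cod C m)"
    using comp_hom[OF _ M_hom[OF m], of s "Dom C s"] M_hom[OF sM(1)] sM(2) by simp
  have "m \<cdot> s \<in> bot_sub (Cod C m)"
    unfolding smallest_sub_def admissible_def using M_comp[OF m sM] homD[OF H] I by auto
  then show ?thesis
    using sub_eq_if_common[OF direct_image_sub[OF m bot_sub[OF O(1)]] bot_sub[OF O(2)]]
      comp_in_direct_image[OF m bot_sub[OF O(1)] s] by blast
qed

section \<open>Closed subobjects\<close>

lemma spaceD:
  assumes "preneighbourhood_space C E M X \<mu>"
  shows "X \<in> Obj C"
    and "x \<in> sub X \<Longrightarrow> \<mu> x \<in> Fil C M X"
    and "x \<in> sub X \<Longrightarrow> \<mu> x \<subseteq> sub X"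
    and "\<lbrakk>x \<in> sub X; y \<in> sub X; below X x y\<rbrakk> \<Longrightarrow> \<mu> y \<subseteq> \<mu> x"
    and "\<mu> (bot_sub X) = sub X"
    and "\<lbrakk>x \<in> sub X; p \<in> \<mu> x\<rbrakk> \<Longrightarrow> below X x p"
  using assms unfolding preneighbourhood_space_def preneighbourhood_system_def
  by (auto simp: Fil_def Pi_iff)

lemma FilD:
  assumes "F \<in> Fil C M X"
  shows "F \<subseteq> sub X"
    and "\<lbrakk>p \<in> F; q \<in> sub X; below X p q\<rbrakk> \<Longrightarrow> q \<in> F"
    and "\<lbrakk>finite S; S \<subseteq> F\<rbrakk> \<Longrightarrow> \<Sqinter>\<^bsub>Sub C M X\<^esub> S \<in> F"
  using assms unfolding Fil_def by auto

lemma Far_iff: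
  assumes \<mu>: "preneighbourhood_space C E M X \<mu>" and x: "x \<in> sub X" and p: "p \<in> sub X"
  shows "x \<in> Far C E M X \<mu> p \<longleftrightarrow>
    (\<exists>u \<in> \<mu> x. \<forall>z \<in> sub X. below X z u \<longrightarrow> below X z p \<longrightarrow> below X z (bot_sub X))"
proof -
  note bot = bot_sub[OF spaceD(1)[OF \<mu>]] bot_below[OF spaceD(1)[OF \<mu>]]
  have "u \<sqinter>\<^bsub>Sub C M X\<^esub> p = bot_sub X \<longleftrightarrow>
      (\<forall>z \<in> sub X. below X z u \<longrightarrow> below X z p \<longrightarrow> below X z (bot_sub X))"
    if "u \<in> \<mu> x" for u
  proof -
    have u: "u \<in> sub X" using spaceD(3)[OF \<mu> x] that by blast
    note up = meet_sub[OF u p]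
    show ?thesis
    proof
      assume "u \<sqinter>\<^bsub>Sub C M X\<^esub> p = bot_sub X"
      then show "\<forall>z \<in> sub X. below X z u \<longrightarrow> below X z p \<longrightarrow> below X z (bot_sub X)"
        using up(4) by metis
    next
      assume "\<forall>z \<in> sub X. below X z u \<longrightarrow> below X z p \<longrightarrow> below X z (bot_sub X)"
      then have "below X (u \<sqinter>\<^bsub>Sub C M X\<^esub> p) (bot_sub X)" using up(1,2,3) by blast
      then show "u \<sqinter>\<^bsub>Sub C M X\<^esub> p = bot_sub X"
        using below_antisym bot(2)[OF up(1)] up(1) bot(1) by blast
    qed
  qed
  then show ?thesis using x unfolding Far_def by blast
qed

lemma Far_antimono:
  assumes \<mu>: "preneighbourhood_space C E M X \<mu>" and x: "x \<in> Far C E M X \<mu> q"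
    and pq: "p \<in> sub X" "q \<in> sub X" "below X p q"
  shows "x \<in> Far C E M X \<mu> p"
proof -
  have xs: "x \<in> sub X" using x by (simp add: Far_def)
  obtain u where "u \<in> \<mu> x"
    "\<forall>z \<in> sub X. below X z u \<longrightarrow> below X z q \<longrightarrow> below X z (bot_sub X)"
    using x unfolding Far_iff[OF \<mu> xs pq(2)] by blast
  then show ?thesis
    unfolding Far_iff[OF \<mu> xs pq(1)] using below_trans[OF _ pq(3) _ pq(1,2)] by blast
qed

text \<open>The supremum defining the closure is always above \<open>p\<close>: the subobject \<open>p\<close> itself takes part in
  it unless it is far from itself, and this happens only when \<open>p\<close> is the smallest subobject.\<close>

lemma closed_iff:
  assumes \<mu>: "preneighbourhood_space C E M X \<mu>"
  shows "p \<in> closed_subs C E M X \<mu> \<longleftrightarrow> p \<in> sub X \<and>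
    (\<forall>x \<in> sub X. below X x p \<or> below X p x \<or> x \<in> Far C E M X \<mu> p)"
proof (cases "p \<in> sub X")
  case p: True
  note X = spaceD(1)[OF \<mu>]
  define S where "S = {x \<in> sub X. \<not> (below X p x \<and> p \<noteq> x) \<and> x \<notin> Far C E M X \<mu> p}"
  have S: "S \<subseteq> sub X" by (auto simp: S_def)
  have cl: "cl C E M X \<mu> p = \<Squnion>\<^bsub>Sub C M X\<^esub> S"
    by (simp add: cl_def S_def strictly_below_iff)
  note Sup = Sup_sub[OF X S]
  have above: "below X p (\<Squnion>\<^bsub>Sub C M X\<^esub> S)"
  proof (cases "p \<in> Far C E M X \<mu> p")
    case True
    then obtain u where u: "u \<in> \<mu> p"
      "\<forall>z \<in> sub X. below X z u \<longrightarrow> below X z p \<longrightarrow> below X z (bot_sub X)"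
      using Far_iff[OF \<mu> p p] by blast
    have "below X p (bot_sub X)" using u spaceD(6)[OF \<mu> p u(1)] below_refl[OF p] p by blast
    then show ?thesis
      using below_trans[OF _ bot_below[OF X Sup(1)] p bot_sub[OF X] Sup(1)] by blast
  next
    case False
    then have "p \<in> S" using p by (simp add: S_def)
    then show ?thesis by (rule Sup(2))
  qed
  have "\<Squnion>\<^bsub>Sub C M X\<^esub> S = p \<longleftrightarrow> (\<forall>x \<in> S. below X x p)"
  proof
    assume "\<Squnion>\<^bsub>Sub C M X\<^esub> S = p"
    then show "\<forall>x \<in> S. below X x p" using Sup(2) by blast
  next
    assume "\<forall>x \<in> S. below X x p"
    then have "below X (\<Squnion>\<^bsub>Sub C M X\<^esub> S) p" using Sup(3)[OF p] by blast
    then show "\<Squnion>\<^bsub>Sub C M X\<^esub> S = p" using below_antisym[OF _ above Sup(1) p] by blast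
  qed
  also have "\<dots> \<longleftrightarrow> (\<forall>x \<in> sub X. below X x p \<or> below X p x \<or> x \<in> Far C E M X \<mu> p)"
    using below_refl[OF p] by (auto simp: S_def)
  finally show ?thesis using p cl by (simp add: closed_subs_def)
qed (simp add: closed_subs_def)

text \<open>If \<open>x\<close> is not below the infimum, it fails to be below some member \<open>p\<close>; being above \<open>p\<close> or far
  from \<open>p\<close> is inherited by everything smaller than \<open>p\<close>.\<close>

lemma closed_Inf:
  assumes \<mu>: "preneighbourhood_space C E M X \<mu>" and S: "S \<subseteq> closed_subs C E M X \<mu>"
  shows "\<Sqinter>\<^bsub>Sub C M X\<^esub> S \<in> closed_subs C E M X \<mu>"
proof -
  have Ss: "S \<subseteq> sub X" using S by (auto simp: closed_subs_def)
  note Inf = Inf_sub[OF spaceD(1)[OF \<mu>] Ss]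
  let ?i = "\<Sqinter>\<^bsub>Sub C M X\<^esub> S"
  have "below X x ?i \<or> below X ?i x \<or> x \<in> Far C E M X \<mu> ?i" if x: "x \<in> sub X" for x
  proof (cases "\<exists>p \<in> S. \<not> below X x p")
    case True
    then obtain p where p: "p \<in> S" "\<not> below X x p" by blast
    have ps: "p \<in> sub X" using p Ss by blast
    have "below X p x \<or> x \<in> Far C E M X \<mu> p"
      using S p x closed_iff[OF \<mu>] by blast
    then show ?thesis
      using below_trans[OF Inf(2)[OF p(1)] _ Inf(1) ps x] Far_antimono[OF \<mu> _ Inf(1) ps Inf(2)[OF p(1)]]
      by blast
  next
    case False
    then show ?thesis using Inf(3)[OF x] by blast
  qed
  then show ?thesis using closed_iff[OF \<mu>] Inf(1) by blast
qed

section \<open>The restriction of a preneighbourhood system to a subobject\<close>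

text \<open>The coarsest preneighbourhood system for which \<open>m\<close> is a preneighbourhood morphism. The
  preimages of a filter generate a filter by monotonicity of the preimage alone.\<close>

definition restrict_system :: "'a \<Rightarrow> ('a set \<Rightarrow> 'a set set) \<Rightarrow> 'a set \<Rightarrow> 'a set set"
  where "restrict_system m \<phi> u = {v \<in> sub (Dom C m).
    \<exists>p \<in> \<phi> (direct_image m u). below (Dom C m) (preimage C m p) v}"

lemma restrict_system_space:
  assumes m: "m \<in> M" and \<phi>: "preneighbourhood_space C E M (Cod C m) \<phi>"
  shows "preneighbourhood_space C E M (Dom C m) (restrict_system m \<phi>)"
proof -
  let ?A = "Dom C m" and ?Y = "Cod C m" and ?\<mu> = "restrict_system m \<phi>"
  have A: "?A \<in> Obj C" using dom_obj[OF M_arr[OF m]] .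
  note mH = M_hom[OF m]
  note pre = preimage_sub[OF mH] and pre_mono = preimage_mono[OF mH] and im = direct_image_sub[OF m]
  have fil: "?\<mu> u \<in> Fil C M ?A" if u: "u \<in> sub ?A" for u
    unfolding Fil_def
  proof (safe)
    note F = FilD[OF spaceD(2)[OF \<phi> im[OF u]]]
    show "v \<in> sub ?A" if "v \<in> ?\<mu> u" for v using that by (simp add: restrict_system_def)
    show "q \<in> ?\<mu> u" if "v \<in> ?\<mu> u" "q \<in> sub ?A" "below ?A v q" for v q
      using that pre F(1) below_trans[OF _ that(3)] unfolding restrict_system_def by blast
    fix S assume S: "finite S" "S \<subseteq> ?\<mu> u"
    have Ss: "S \<subseteq> sub ?A" using S by (auto simp: restrict_system_def)
    have "\<forall>v \<in> S. \<exists>p. p \<in> \<phi> (direct_image m u) \<and> below ?A (preimage C m p) v"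
      using S by (auto simp: restrict_system_def)
    then obtain w where w: "\<And>v. v \<in> S \<Longrightarrow> w v \<in> \<phi> (direct_image m u)"
      "\<And>v. v \<in> S \<Longrightarrow> below ?A (preimage C m (w v)) v"
      by metis
    let ?p = "\<Sqinter>\<^bsub>Sub C M ?Y\<^esub> (w ` S)"
    have wS: "w ` S \<subseteq> \<phi> (direct_image m u)" using w(1) by blast
    have wY: "w ` S \<subseteq> sub ?Y" using wS F(1) by blast
    have p: "?p \<in> \<phi> (direct_image m u)" using F(3)[OF _ wS] S(1) by simp
    note Inf = Inf_sub[OF spaceD(1)[OF \<phi>] wY]
    have "below ?A (preimage C m ?p) v" if v: "v \<in> S" for v
    proof -
      have wv: "w v \<in> sub ?Y" using wY v by blast
      have vs: "v \<in> sub ?A" using Ss v by blast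
      have "below ?A (preimage C m ?p) (preimage C m (w v))"
        using pre_mono[OF Inf(1) wv] Inf(2) v by blast
      then show ?thesis using below_trans[OF _ w(2)[OF v] pre[OF Inf(1)] pre[OF wv] vs] by blast
    qed
    then have "below ?A (preimage C m ?p) (\<Sqinter>\<^bsub>Sub C M ?A\<^esub> S)"
      using Inf_sub(3)[OF A Ss pre[OF Inf(1)]] by blast
    then show "\<Sqinter>\<^bsub>Sub C M ?A\<^esub> S \<in> ?\<mu> u"
      using p Inf_sub(1)[OF A Ss] unfolding restrict_system_def by blast
  qed
  have anti: "?\<mu> v \<subseteq> ?\<mu> u" if "u \<in> sub ?A" "v \<in> sub ?A" "below ?A u v" for u v
    using spaceD(4)[OF \<phi> im[OF that(1)] im[OF that(2)]] direct_image_order_embedding[OF m that(1,2)]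
      that(3) unfolding restrict_system_def by blast
  have "v \<in> ?\<mu> (bot_sub ?A)" if v: "v \<in> sub ?A" for v
  proof -
    have "direct_image m v \<in> \<phi> (direct_image m (bot_sub ?A))"
      using direct_image_bot[OF m] spaceD(5)[OF \<phi>] im[OF v] by simp
    then show ?thesis
      using preimage_direct_image[OF m v] below_refl[OF v] v unfolding restrict_system_def
      by (intro CollectI conjI bexI[of _ "direct_image m v"]) simp_all
  qed
  then have bot: "?\<mu> (bot_sub ?A) = sub ?A" by (auto simp: restrict_system_def)
  have "below ?A u v" if u: "u \<in> sub ?A" and v: "v \<in> ?\<mu> u" for u v
  proof -
    obtain p where p: "p \<in> \<phi> (direct_image m u)" "below ?A (preimage C m p) v" "v \<in> sub ?A"
      using v by (auto simp: restrict_system_def)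
    have ps: "p \<in> sub ?Y" using spaceD(3)[OF \<phi> im[OF u]] p(1) by blast
    have "below ?A u (preimage C m p)"
      using direct_image_below_iff[OF m u ps] spaceD(6)[OF \<phi> im[OF u] p(1)] by simp
    then show ?thesis using below_trans[OF _ p(2) u pre[OF ps] p(3)] by blast
  qed
  then show ?thesis
    unfolding preneighbourhood_space_def preneighbourhood_system_def
    using A fil anti bot by blast
qed

text \<open>Comparability descends along the order embedding \<open>direct_image m\<close>, and a neighbourhood \<open>p\<close>
  of the image of \<open>x\<close> that misses \<open>t\<close> has a preimage that misses the preimage of \<open>t\<close>.\<close>

lemma closed_preimage:
  assumes m: "m \<in> M" and \<phi>: "preneighbourhood_space C E M (Cod C m) \<phi>"
    and t: "t \<in> closed_subs C E M (Cod C m) \<phi>"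
  shows "preimage C m t \<in> closed_subs C E M (Dom C m) (restrict_system m \<phi>)"
proof -
  let ?A = "Dom C m" and ?Y = "Cod C m" and ?\<mu> = "restrict_system m \<phi>"
  have A: "?A \<in> Obj C" using dom_obj[OF M_arr[OF m]] .
  note mH = M_hom[OF m]
  note pre = preimage_sub[OF mH] and im = direct_image_sub[OF m]
  have ts: "t \<in> sub ?Y" using t by (simp add: closed_subs_def)
  have "below ?A x (preimage C m t) \<or> below ?A (preimage C m t) x \<or>
      x \<in> Far C E M ?A ?\<mu> (preimage C m t)" if x: "x \<in> sub ?A" for x
  proof -
    have "below ?Y (direct_image m x) t \<or> below ?Y t (direct_image m x) \<or>
        direct_image m x \<in> Far C E M ?Y \<phi> t"
      using t im[OF x] closed_iff[OF \<phi>] by blast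
    then consider "below ?Y (direct_image m x) t" | "below ?Y t (direct_image m x)"
      | "direct_image m x \<in> Far C E M ?Y \<phi> t" by blast
    then show ?thesis
    proof cases
      case 1
      then show ?thesis using direct_image_below_iff[OF m x ts] by simp
    next
      case 2
      then show ?thesis
        using preimage_mono[OF mH ts im[OF x]] preimage_direct_image[OF m x] by simp
    next
      case 3
      then obtain p where p: "p \<in> \<phi> (direct_image m x)"
        and miss: "\<And>z. \<lbrakk>z \<in> sub ?Y; below ?Y z p; below ?Y z t\<rbrakk> \<Longrightarrow> below ?Y z (bot_sub ?Y)"
        unfolding Far_iff[OF \<phi> im[OF x] ts] by blast
      have ps: "p \<in> sub ?Y" using spaceD(3)[OF \<phi> im[OF x]] p by blast
      have "preimage C m p \<in> ?\<mu> x"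
        using p below_refl pre[OF ps] unfolding restrict_system_def by blast
      moreover have "below ?A z (bot_sub ?A)"
        if z: "z \<in> sub ?A" "below ?A z (preimage C m p)" "below ?A z (preimage C m t)" for z
        using miss[OF im[OF z(1)]] z(2,3) direct_image_below_iff[OF m z(1)] ps ts
          direct_image_order_embedding[OF m z(1) bot_sub[OF A]] direct_image_bot[OF m] by simp
      ultimately show ?thesis
        using Far_iff[OF restrict_system_space[OF m \<phi>] x pre[OF ts]] by blast
    qed
  qed
  then show ?thesis
    using closed_iff[OF restrict_system_space[OF m \<phi>]] pre[OF ts] by blast
qed

text \<open>Let \<open>x\<close> be a subobject of the codomain. If \<open>x\<close> is below \<open>m\<close>, the claim about \<open>x\<close> comes from the
  closedness of \<open>n\<close>; otherwise \<open>x\<close> is above \<open>m\<close> or far from \<open>m\<close>, hence also from the smaller image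
  of \<open>n\<close>.\<close>

lemma closed_direct_image:
  assumes m: "m \<in> M" and \<phi>: "preneighbourhood_space C E M (Cod C m) \<phi>"
    and mc: "subobject m \<in> closed_subs C E M (Cod C m) \<phi>"
    and n: "n \<in> closed_subs C E M (Dom C m) (restrict_system m \<phi>)"
  shows "direct_image m n \<in> closed_subs C E M (Cod C m) \<phi>"
proof -
  let ?A = "Dom C m" and ?Y = "Cod C m" and ?\<mu> = "restrict_system m \<phi>"
  have A: "?A \<in> Obj C" using dom_obj[OF M_arr[OF m]] .
  note mH = M_hom[OF m]
  note pre = preimage_sub[OF mH] and im = direct_image_sub[OF m] and ms = subobject_sub[OF m]
  note \<mu> = restrict_system_space[OF m \<phi>]
  have ns: "n \<in> sub ?A" using n by (simp add: closed_subs_def)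
  note nm = direct_image_below[OF m ns]
  have "below ?Y x (direct_image m n) \<or> below ?Y (direct_image m n) x \<or>
      x \<in> Far C E M ?Y \<phi> (direct_image m n)" if x: "x \<in> sub ?Y" for x
  proof (cases "below ?Y x (subobject m)")
    case True
    define x' where "x' = preimage C m x"
    have x': "x' \<in> sub ?A" and xx': "x = direct_image m x'"
      using pre[OF x] direct_image_preimage[OF m x True] by (auto simp: x'_def)
    consider "below ?A x' n" | "below ?A n x'" | "x' \<in> Far C E M ?A ?\<mu> n"
      using n closed_iff[OF \<mu>] x' by blast
    then show ?thesis
    proof cases
      case 3
      then obtain v where v: "v \<in> ?\<mu> x'"
        and miss: "\<And>z. \<lbrakk>z \<in> sub ?A; below ?A z v; below ?A z n\<rbrakk> \<Longrightarrow> below ?A z (bot_sub ?A)"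
        unfolding Far_iff[OF \<mu> x' ns] by blast
      then obtain p where p: "p \<in> \<phi> x" "below ?A (preimage C m p) v" and vs: "v \<in> sub ?A"
        using xx' by (auto simp: restrict_system_def)
      have ps: "p \<in> sub ?Y" using spaceD(3)[OF \<phi> x] p(1) by blast
      have "below ?Y z (bot_sub ?Y)"
        if z: "z \<in> sub ?Y" and zp: "below ?Y z p" and zn: "below ?Y z (direct_image m n)" for z
      proof -
        define z' where "z' = preimage C m z"
        have z': "z' \<in> sub ?A" using pre[OF z] by (simp add: z'_def)
        have zz': "direct_image m z' = z"
          using direct_image_preimage[OF m z] below_trans[OF zn nm z im[OF ns] ms]
          by (simp add: z'_def)
        have "below ?A z' (preimage C m p)"
          using direct_image_below_iff[OF m z' ps] zp zz' by simp
        then have "below ?A z' v" using below_trans[OF _ p(2) z' pre[OF ps] vs] by blast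
        moreover have "below ?A z' n"
          using direct_image_order_embedding[OF m z' ns] zz' zn by simp
        ultimately have "below ?A z' (bot_sub ?A)" using miss[OF z'] by blast
        then show ?thesis
          using direct_image_order_embedding[OF m z' bot_sub[OF A]] direct_image_bot[OF m] zz' by simp
      qed
      then show ?thesis using p(1) unfolding Far_iff[OF \<phi> x im[OF ns]] by blast
    qed (use xx' direct_image_order_embedding[OF m] x' ns in auto)
  next
    case False
    then have "below ?Y (subobject m) x \<or> x \<in> Far C E M ?Y \<phi> (subobject m)"
      using mc x closed_iff[OF \<phi>] by blast
    then show ?thesis
      using below_trans[OF nm _ im[OF ns] ms x] Far_antimono[OF \<phi> _ im[OF ns] ms nm] by blast
  qed
  then show ?thesis using closed_iff[OF \<phi>] im[OF ns] by blast
qed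

section \<open>The dense part of a preneighbourhood morphism\<close>

text \<open>A neighbourhood of \<open>u\<close> in the restriction contains the preimage of a neighbourhood \<open>p\<close> of the
  image of \<open>u\<close>, and the preimages of \<open>p\<close> and of that image along \<open>m \<cdot> h\<close> are their preimages along
  \<open>m\<close> and then along \<open>h\<close>; the image of \<open>u\<close> pulls back to \<open>u\<close>.\<close>

lemma morphism_into_restriction:
  assumes f: "preneighbourhood_morphism C E M X \<mu> (Cod C m) \<phi> (m \<cdot> h)"
    and m: "m \<in> M" and h: "h \<in> Hom C X (Dom C m)"
  shows "preneighbourhood_morphism C E M X \<mu> (Dom C m) (restrict_system m \<phi>) h"
proof -
  have \<mu>: "preneighbourhood_space C E M X \<mu>" and \<phi>: "preneighbourhood_space C E M (Cod C m) \<phi>"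
    and nb: "\<And>u p. \<lbrakk>u \<in> sub (Cod C m); p \<in> \<phi> u\<rbrakk> \<Longrightarrow> preimage C (m \<cdot> h) p \<in> \<mu> (preimage C (m \<cdot> h) u)"
    using f by (auto simp: preneighbourhood_morphism_def)
  note mH = M_hom[OF m]
  have "preimage C h v \<in> \<mu> (preimage C h u)"
    if u: "u \<in> sub (Dom C m)" and v: "v \<in> restrict_system m \<phi> u" for u v
  proof -
    note mu = direct_image_sub[OF m u]
    obtain p where p: "p \<in> \<phi> (direct_image m u)" "below (Dom C m) (preimage C m p) v"
      and vs: "v \<in> sub (Dom C m)"
      using v by (auto simp: restrict_system_def)
    have ps: "p \<in> sub (Cod C m)" using spaceD(3)[OF \<phi> mu] p(1) by blast
    have "preimage C h (preimage C m p) \<in> \<mu> (preimage C h u)"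
      using nb[OF mu p(1)] preimage_comp[OF h mH ps] preimage_comp[OF h mH mu]
        preimage_direct_image[OF m u] by simp
    then show ?thesis
      using FilD(2)[OF spaceD(2)[OF \<mu> preimage_sub[OF h u]]] preimage_sub[OF h vs]
        preimage_mono[OF h preimage_sub[OF mH ps] vs p(2)] by blast
  qed
  then show ?thesis
    unfolding preneighbourhood_morphism_def
    using \<mu> restrict_system_space[OF m \<phi>] h by blast
qed

text \<open>The witness is the infimum of all closed subobjects through which \<open>f\<close> factors; \<open>f\<close> factors through it because its image lies below every member of that family.\<close>

lemma least_closed_factorization:
  assumes \<phi>: "preneighbourhood_space C E M Y \<phi>" and f: "f \<in> Hom C X Y"
  obtains t where "t \<in> closed_subs C E M Y \<phi>" "lies_in f t"
    "\<And>s. \<lbrakk>s \<in> closed_subs C E M Y \<phi>; lies_in f s\<rbrakk> \<Longrightarrow> below Y t s"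
proof -
  define S where "S = {s \<in> closed_subs C E M Y \<phi>. lies_in f s}"
  have S: "S \<subseteq> closed_subs C E M Y \<phi>" "S \<subseteq> sub Y" by (auto simp: S_def closed_subs_def)
  note Inf = Inf_sub[OF spaceD(1)[OF \<phi>] S(2)]
  obtain i where i: "i \<in> sub Y" "\<And>p. p \<in> sub Y \<Longrightarrow> lies_in f p \<longleftrightarrow> below Y i p"
    using image_exists[OF f] by blast
  have "below Y i (\<Sqinter>\<^bsub>Sub C M Y\<^esub> S)"
    using Inf(3)[OF i(1)] i(2) S(2) by (auto simp: S_def)
  then have "lies_in f (\<Sqinter>\<^bsub>Sub C M Y\<^esub> S)" using i(2)[OF Inf(1)] by simp
  then show ?thesis
    using that[OF closed_Inf[OF \<phi> S(1)]] Inf(2) by (simp add: S_def)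
qed

text \<open>If \<open>h\<close> factors through a closed \<open>n\<close>, then \<open>m \<cdot> h\<close> factors through \<open>m \<cdot> n\<close>, which is closed; so
  minimality gives \<open>m = m \<cdot> n \<cdot> r\<close> for some \<open>r\<close>. As \<open>m\<close> and \<open>n\<close> are monomorphisms, \<open>r\<close> is the
  inverse of \<open>n\<close>.\<close>

lemma dense_if_least_closed:
  assumes \<mu>: "preneighbourhood_space C E M X \<mu>" and \<phi>: "preneighbourhood_space C E M (Cod C m) \<phi>"
    and m: "m \<in> M" and h: "h \<in> Hom C X (Dom C m)"
    and closed: "subobject m \<in> closed_subs C E M (Cod C m) \<phi>"
    and least: "\<And>s. \<lbrakk>s \<in> closed_subs C E M (Cod C m) \<phi>; lies_in (m \<cdot> h) s\<rbrakk>
      \<Longrightarrow> below (Cod C m) (subobject m) s"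
  shows "dense_morphism C E M X \<mu> (Dom C m) (restrict_system m \<phi>) h"
proof -
  have "is_isomorphism C n"
    if t: "t \<in> closed_subs C E M (Dom C m) (restrict_system m \<phi>)" and n: "n \<in> t"
      and k: "k \<in> Hom C X (Dom C n)" "h = n \<cdot> k" for t n k
  proof -
    have ts: "t \<in> sub (Dom C m)" using t by (simp add: closed_subs_def)
    have nM: "n \<in> M" "Cod C n = Dom C m" using sub_mem[OF ts n] by auto
    have "lies_in h t" using lies_in_comp[OF ts lies_in_self[OF ts n] k(1)] k(2) by simp
    then have "lies_in (m \<cdot> h) (direct_image m t)" using lies_in_direct_image[OF m ts] by blast
    then have "below (Cod C m) (subobject m) (direct_image m t)"
      using least closed_direct_image[OF m \<phi> closed t] by blast
    then have "lies_in m (direct_image m t)"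
      using below_iff_rep[OF subobject_sub[OF m] direct_image_sub[OF m ts] subobject_self[OF m]] by simp
    then obtain l where l: "lies_in l t" "m = m \<cdot> l" using lies_in_direct_image[OF m ts] by blast
    have mH: "m \<in> Hom C (Dom C m) (Cod C m)" using M_hom[OF m] .
    have idm: "Id C (Dom C m) \<in> Hom C (Dom C m) (Dom C m)" using id_hom[OF dom_obj[OF M_arr[OF m]]] .
    have lH: "l \<in> Hom C (Dom C l) (Dom C m)" using lies_in_hom[OF ts l(1)] .
    have "Dom C l = Dom C m" using homD(2)[OF comp_hom[OF lH mH]] l(2) by simp
    then have "l = Id C (Dom C m)"
      using mono_cancel[OF M_mono[OF m] _ idm] lH l(2)[symmetric] comp_id[OF mH] by simp
    then have "factors_through C (Id C (Dom C m)) n" using l(1) lies_in_iff[OF ts n] by simp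
    then obtain r where r: "r \<in> Hom C (Dom C m) (Dom C n)" "Id C (Dom C m) = n \<cdot> r"
      using homD(2)[OF idm] unfolding factors_through_def by auto
    have nH: "n \<in> Hom C (Dom C n) (Dom C m)" using M_hom[OF nM(1)] nM(2) by simp
    have idn: "Id C (Dom C n) \<in> Hom C (Dom C n) (Dom C n)" using id_hom[OF dom_obj[OF M_arr[OF nM(1)]]] .
    have "n \<cdot> (r \<cdot> n) = n \<cdot> Id C (Dom C n)"
      using comp_assoc[OF nH r(1) nH] r(2)[symmetric] id_comp[OF nH] comp_id[OF nH] by simp
    then have "r \<cdot> n = Id C (Dom C n)"
      using mono_cancel[OF M_mono[OF nM(1)] comp_hom[OF nH r(1)] idn] by blast
    then show ?thesis
      unfolding is_isomorphism_def using r M_arr[OF nM(1)] nM(2) by auto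
  qed
  then show ?thesis
    unfolding dense_morphism_def using \<mu> restrict_system_space[OF m \<phi>] h by blast
qed

lemma continuous_if_dense_continuous:
  assumes dense: "\<And>A \<nu> h. \<lbrakk>preneighbourhood_morphism C E M X \<mu> A \<nu> h;
      dense_morphism C E M X \<mu> A \<nu> h\<rbrakk> \<Longrightarrow> continuous_morphism C E M X \<mu> A \<nu> h"
    and f: "preneighbourhood_morphism C E M X \<mu> Y \<phi> f"
  shows "continuous_morphism C E M X \<mu> Y \<phi> f"
proof -
  have \<mu>: "preneighbourhood_space C E M X \<mu>" and \<phi>: "preneighbourhood_space C E M Y \<phi>"
    and fH: "f \<in> Hom C X Y"
    using f by (auto simp: preneighbourhood_morphism_def)
  obtain t where t: "t \<in> closed_subs C E M Y \<phi>" "lies_in f t"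
    and least: "\<And>s. \<lbrakk>s \<in> closed_subs C E M Y \<phi>; lies_in f s\<rbrakk> \<Longrightarrow> below Y t s"
    using least_closed_factorization[OF \<phi> fH] by blast
  have "t \<in> sub Y" using t(1) by (simp add: closed_subs_def)
  then obtain m where m: "m \<in> M" and Y: "Y = Cod C m" and tm: "t = subobject m"
    using sub_iff by auto
  obtain h where h: "h \<in> Hom C X (Dom C m)" and fmh: "f = m \<cdot> h"
    using t(2) lies_in_subobject[OF m] homD(2)[OF fH] unfolding tm factors_through_def by auto
  let ?\<nu> = "restrict_system m \<phi>"
  note \<phi>m = \<phi>[unfolded Y]
  have "preneighbourhood_morphism C E M X \<mu> (Dom C m) ?\<nu> h"
    using morphism_into_restriction[OF _ m h] f unfolding Y fmh by blast
  moreover have "dense_morphism C E M X \<mu> (Dom C m) ?\<nu> h"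
    using dense_if_least_closed[OF \<mu> \<phi>m m h] t(1) least unfolding Y tm fmh by blast
  ultimately have cont: "continuous_morphism C E M X \<mu> (Dom C m) ?\<nu> h" by (rule dense)
  have "preimage C f s \<in> closed_subs C E M X \<mu>" if s: "s \<in> closed_subs C E M Y \<phi>" for s
  proof -
    have "s \<in> sub (Cod C m)" using s Y by (simp add: closed_subs_def)
    then have "preimage C f s = preimage C h (preimage C m s)"
      using preimage_comp[OF h M_hom[OF m]] fmh by simp
    moreover have "preimage C m s \<in> closed_subs C E M (Dom C m) ?\<nu>"
      using closed_preimage[OF m \<phi>m] s Y by simp
    ultimately show ?thesis using cont by (simp add: continuous_morphism_def)
  qed
  then show ?thesis unfolding continuous_morphism_def using \<mu> \<phi> fH by blast
qed

end

theorem mainTheorem9: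
  fixes C :: "('o, 'a) cat" and E M :: "'a set"
  assumes "preneighbourhood_context C E M"
  shows "(\<forall>X \<mu> Y \<phi> f. preneighbourhood_morphism C E M X \<mu> Y \<phi> f \<longrightarrow>
            continuous_morphism C E M X \<mu> Y \<phi> f)
    \<longleftrightarrow> (\<forall>X \<mu> Y \<phi> f. preneighbourhood_morphism C E M X \<mu> Y \<phi> f \<and>
            dense_morphism C E M X \<mu> Y \<phi> f \<longrightarrow>
            continuous_morphism C E M X \<mu> Y \<phi> f)"
proof -
  interpret preneighbourhood_context C E M by (rule assms)
  show ?thesis using continuous_if_dense_continuous by blast
qed

end
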